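(* Let $(K,v)$ be a henselian valued field, let $F\in K[x]$ be monic irreducible of degree $>1$, and consider a Mac Lane–Vaquié (MLV) chain of $v_F$: $$ \mu_0\ \stackrel{\phi_1,\gamma_1}{\longrightarrow}\ \mu_1\ \longrightarrow\ \cdots\ \stackrel{\phi_{r-1},\gamma_{r-1}}{\longrightarrow}\ \mu_{r-1}\ \stackrel{\phi_{r},\gamma_{r}}{\longrightarrow}\ \mu_{r}\ \stackrel{F,\infty}{\longrightarrow}\ \mu_{r+1}=v_F . $$ Take $\Phi_{r+1}=\{F\}$. For each $0\le\ell\le r$, consider the following set of monic irreducible polynomials of constant degree: $$ \Phi_\ell=\begin{cases}\{\phi_\ell\}, &\text{if } \mu_{\ell+1}=[\mu_\ell;\,\phi_{\ell+1},\gamma_{\ell+1}]\text{ is an ordinary augmentation},\\ \{\chi_i\mid i\in A_\ell\}, &\text{if } \mu_{\ell+1}=[\mathcal{A}_\ell;\,\phi_{\ell+1},\gamma_{\ell+1}]\text{ is a limit augmentation},\end{cases} $$ where $\mathcal{A}_\ell=(\rho_i)_{i\in A_\ell}$ and $\chi_i\in\mathrm{KP}(\mu_\ell)$ are polynomials of degree $\deg(\mu_\ell)$ with $\rho_i=[\mu_\ell;\,\chi_i,v_F(\chi_i)]$ for all $i\in A_\ell$ (for the first index $i$, for which $\rho_i=\mu_\ell$, this means $v_F(\chi_i)=\mu_\ell(\chi_i)$). Then $[\Phi_0,\dots,\Phi_r,\Phi_{r+1}]$ is an Okutsu frame of $F$.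
   Context: **Valuations.** $(K,v)$ is a henselian valued field, $\Gamma=v(K^* )$, $\Gamma_{\mathbb{Q}}=\Gamma\otimes\mathbb{Q}$; $v$ also denotes its unique extension to an algebraic closure $\overline{K}$. For $F\in K[x]$ monic irreducible, $v_F(f)=v(f(\theta))$ for $f\in K[x]$, where $\theta\in\overline K$ is any root of $F$; it is a valuation with support $FK[x]$. All valuations considered are valuations $\mu\colon K[x]\to\Gamma_{\mathbb{Q}}\cup\{\infty\}$ with $\mu|_K=v$ (nonzero support $\mu^{-1}(\infty)$ allowed), ordered by $\mu\le\nu\iff\mu(f)\le\nu(f)$ for all $f$. **Key polynomials.** For $\alpha\in\Gamma_\mu$ let $\mathcal{P}_\alpha=\{g\mid\mu(g)\ge\alpha\}\supset\mathcal{P}_\alpha^+=\{g\mid\mu(g)>\alpha\}$, $\mathcal{G}_\mu=\bigoplus_{\alpha}\mathcal{P}_\alpha/\mathcal{P}_\alpha^+$; $\mathrm{in}_\mu g$ is the class of $g$ in $\mathcal{P}_{\mu(g)}/\mathcal{P}^+_{\mu(g)}$ if $\mu(g)<\infty$ and $0$ otherwise. $g\sim_\mu h$ means $\mathrm{in}_\mu g=\mathrm{in}_\mu h$; $h\mid_\mu g$ means $\mathrm{in}_\mu h\mid\mathrm{in}_\mu g$ in $\mathcal{G}_\mu$. A key polynomial for $\mu$ is a monic $\phi$ such that $\mathrm{in}_\mu\phi$ generates a nonzero prime ideal ($\mu$-irreducible) and $\phi\nmid_\mu f$ for all nonzero $f$ with $\deg f<\deg\phi$ ($\mu$-minimal).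 $\mathrm{KP}(\mu)$ is the set of key polynomials; if nonempty, $\deg(\mu)$ is the minimal degree of a key polynomial. If $\mu$ has support $GK[x]\neq0$ with $G$ monic irreducible, then $\deg(\mu)=\deg(G)$. For $\mu<\nu$, $\mathbf{t}(\mu,\nu)$ is the set of monic $\phi$ of minimal degree with $\mu(\phi)<\nu(\phi)$. **Augmentations.** For $\phi\in\mathrm{KP}(\mu)$ and $\gamma\in\Gamma_{\mathbb{Q}}\cup\{\infty\}$ with $\gamma>\mu(\phi)$, the ordinary augmentation $[\mu;\phi,\gamma]$ sends $f=\sum_s a_s\phi^s$ ($\deg a_s<\deg\phi$) to $\min_s\{\mu(a_s)+s\gamma\}$. (If $\deg\phi=\deg\mu$ and $\gamma=\mu(\phi)$, the same formula returns $\mu$.) Let $\mathcal{A}=(\rho_i)_{i\in A}$ be a totally ordered family of valuations without maximal element, $i\mapsto\rho_i$ being an isomorphism of ordered sets. $f$ is $\mathcal{A}$-stable if for some $i$, $\rho_i(f)=\rho_j(f)$ for all $j>i$, and then $\rho_{\mathcal{A}}(f)$ is this stable value. $\mathrm{KP}_\infty(\mathcal{A})$ is the set of monic $\mathcal{A}$-unstable polynomials of minimal degree; that degree is $\deg_\infty(\mathcal{A})$ ($\infty$ if there are none). $\mathcal{A}$ is an essential continuous family if $\deg(\rho_i)$ is constant, equal to $\deg(\mathcal{A})$, for all large $i$ and $\deg(\mathcal{A})<\deg_\infty(\mathcal{A})<\infty$. For $\phi\in\mathrm{KP}_\infty(\mathcal{A})$ and $\gamma\in\Gamma_{\mathbb{Q}}\cup\{\infty\}$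 with $\gamma>\rho_i(\phi)$ for all $i$, the limit augmentation $[\mathcal{A};\phi,\gamma]$ sends $\sum_s a_s\phi^s$ to $\min_s\{\rho_{\mathcal{A}}(a_s)+s\gamma\}$. **MLV chains.** An MLV chain of $\nu$ is a finite chain $\mu_0\stackrel{\phi_1,\gamma_1}{\longrightarrow}\mu_1\to\cdots\stackrel{\phi_s,\gamma_s}{\longrightarrow}\mu_s=\nu$ with $\deg(\mu_0)=1$, a chosen key polynomial $\phi_0\in\mathrm{KP}(\mu_0)$ of degree $1$ with $\gamma_0=\mu_0(\phi_0)$, in which each step is either an ordinary augmentation $\mu_{n+1}=[\mu_n;\phi_{n+1},\gamma_{n+1}]$ with $\phi_{n+1}\in\mathrm{KP}(\mu_n)$ and $\deg(\mu_n)<\deg(\mu_{n+1})$; or a limit augmentation $\mu_{n+1}=[\mathcal{A}_n;\phi_{n+1},\gamma_{n+1}]$ with $\phi_{n+1}\in\mathrm{KP}_\infty(\mathcal{A}_n)$, where $\mathcal{A}_n$ is an essential continuous family having $\mu_n$ as its first valuation, with $\deg(\mu_n)=\deg(\mathcal{A}_n)$ and $\phi_n\notin\mathbf{t}(\mu_n,\mu_{n+1})$. **Okutsu frames.** Let $n=\deg F>1$. For non-constant $g$ put $\mathrm{wt}(g)=v_F(g)/\deg(g)$. For $1<m\le n$ let $W_m=\{\mathrm{wt}(g)\mid g\in K[x]\text{ monic},\ 0<\deg g<m\}$. An Okutsu frame of $F$ is a list $[\Phi_0,\dots,\Phi_r,\Phi_{r+1}=\{F\}]$ of nonempty sets of monic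 irreducible polynomials such that all polynomials in $\Phi_\ell$ have the same degree $m_\ell$, $1=m_0<m_1<\cdots<m_{r+1}=n$, and for every $0\le\ell\le r$ and every monic $g$ with $0<\deg g<m_{\ell+1}$ there is $\phi\in\Phi_\ell$ with $\mathrm{wt}(g)\le\mathrm{wt}(\phi)$. Okutsu frames are always assumed to satisfy moreover, for $0\le\ell\le r$: (OF1) $\#\Phi_\ell=1$ whenever $\max(W_{m_{\ell+1}})$ exists; (OF2) if $\max(W_{m_{\ell+1}})$ does not exist, $\Phi_\ell$ is totally ordered by $\phi<\phi'\iff v_F(\phi)<v_F(\phi')$ (distinct elements have distinct $v_F$-values); (OF3) $\mathrm{wt}(\phi)<\mathrm{wt}(\varphi)$ for all $\phi\in\Phi_\ell$, $\varphi\in\Phi_{\ell+1}$. *)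

theory Defs
  imports
    "HOL-Algebra.Algebraic_Closure_Type"
    "HOL-Algebra.QuotRing"
    "HOL-Library.Poly_Mapping"
    "HOL-Library.Extended_Nat"
begin

hide_const (open) Divisibility.irreducible Polynomials.degree Polynomials.lead_coeff

section \<open>Ordered groups with a largest element adjoined\<close>

datatype 'g with_top = Fin 'g | Infty

instantiation with_top :: (linorder) linorder
begin

fun less_eq_with_top :: "'a with_top \<Rightarrow> 'a with_top \<Rightarrow> bool" where
  "less_eq_with_top x Infty = True"
| "less_eq_with_top (Fin a) (Fin b) = (a \<le> b)"
| "less_eq_with_top Infty (Fin b) = False"

definition less_with_top :: "'a with_top \<Rightarrow> 'a with_top \<Rightarrow> bool" where
  "less_with_top x y \<longleftrightarrow> x \<le> y \<and> \<not> y \<le> x"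

instance
proof
  fix x y z :: "'a with_top"
  show "x < y \<longleftrightarrow> x \<le> y \<and> \<not> y \<le> x" by (rule less_with_top_def)
  show "x \<le> x" by (cases x) auto
  show "x \<le> y \<Longrightarrow> y \<le> z \<Longrightarrow> x \<le> z" by (cases x; cases y; cases z) auto
  show "x \<le> y \<Longrightarrow> y \<le> x \<Longrightarrow> x = y" by (cases x; cases y) auto
  show "x \<le> y \<or> y \<le> x" by (cases x; cases y) auto
qed

end

instantiation with_top :: (comm_monoid_add) comm_monoid_add
begin

definition zero_with_top :: "'a with_top" where "0 = Fin 0"

fun plus_with_top :: "'a with_top \<Rightarrow> 'a with_top \<Rightarrow> 'a with_top" where
  "plus_with_top (Fin a) (Fin b) = Fin (a + b)"
| "plus_with_top x Infty = Infty"
| "plus_with_top Infty x = Infty"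

instance
proof
  fix x y z :: "'a with_top"
  show "x + y + z = x + (y + z)" by (cases x; cases y; cases z) (auto simp: add.assoc)
  show "x + y = y + x" by (cases x; cases y) (auto simp: add.commute)
  show "0 + x = x" by (cases x) (auto simp: zero_with_top_def)
qed

end

text \<open>In particular \<open>nsmul 0 Infty = 0\<close> and \<open>nsmul n Infty = Infty\<close> for \<open>n > 0\<close>.\<close>

primrec nsmul :: "nat \<Rightarrow> 'b::monoid_add \<Rightarrow> 'b" where
  "nsmul 0 x = 0"
| "nsmul (Suc n) x = x + nsmul n x"

text \<open>The type \<open>'g\<close> plays the role of \<open>\<Gamma> \<otimes> \<rat>\<close>: an ordered (hence torsion-free) abelian group is
  the divisible hull of a subgroup \<open>\<Gamma>\<close>, i.e. \<open>\<Gamma> \<otimes> \<rat>\<close> up to a unique isomorphism over \<open>\<Gamma>\<close>, iff it is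
  divisible and torsion over \<open>\<Gamma>\<close>.\<close>

definition is_divisible_hull :: "'g::linordered_ab_group_add set \<Rightarrow> bool" where
  "is_divisible_hull \<Gamma> \<longleftrightarrow>
     (\<forall>x::'g. \<forall>n>0. \<exists>y. nsmul n y = x) \<and> (\<forall>x::'g. \<exists>n>0. nsmul n x \<in> \<Gamma>)"

section \<open>Valuations\<close>

text \<open>On a field, these axioms force \<open>w x = Infty \<longleftrightarrow> x = 0\<close>; on other rings the support
  \<open>{x. w x = Infty}\<close> may be a nonzero prime ideal.\<close>

definition is_valuation :: "('r::comm_ring_1 \<Rightarrow> 'g::linordered_ab_group_add with_top) \<Rightarrow> bool" where
  "is_valuation w \<longleftrightarrow>
     w 0 = Infty \<and> w 1 = 0 \<and> (\<forall>x y. w (x * y) = w x + w y) \<and> (\<forall>x y. min (w x) (w y) \<le> w (x + y))"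

definition value_group :: "('a::field \<Rightarrow> 'g::linordered_ab_group_add with_top) \<Rightarrow> 'g set" where
  "value_group v = {\<alpha>. \<exists>a. v a = Fin \<alpha>}"

definition extends_to_closure ::
    "('a::field \<Rightarrow> 'g::linordered_ab_group_add with_top) \<Rightarrow> ('a alg_closure \<Rightarrow> 'g with_top) \<Rightarrow> bool" where
  "extends_to_closure v w \<longleftrightarrow> is_valuation w \<and> (\<forall>a. w (to_ac a) = v a)"

text \<open>Henselian means that \<open>v\<close> has a unique extension to the algebraic closure. When \<open>'g\<close> is the divisible hull of the
  value group, every extension is equivalent to exactly one with values in \<open>'g\<close>.\<close>

definition henselian :: "('a::field \<Rightarrow> 'g::linordered_ab_group_add with_top) \<Rightarrow> bool" where
  "henselian v \<longleftrightarrow>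
     is_valuation v \<and> (\<exists>!w. extends_to_closure v w)"

definition closure_val :: "('a::field \<Rightarrow> 'g::linordered_ab_group_add with_top) \<Rightarrow> 'a alg_closure \<Rightarrow> 'g with_top" where
  "closure_val v = (THE w. extends_to_closure v w)"

definition monic :: "'a::field poly \<Rightarrow> bool" where
  "monic f \<longleftrightarrow> lead_coeff f = 1"

text \<open>The valuation \<open>v\<^sub>F\<close>. All roots of \<open>F\<close> give the same valuation when \<open>v\<close> is henselian and
  \<open>F\<close> irreducible.\<close>

definition root_val :: "('a::field \<Rightarrow> 'g::linordered_ab_group_add with_top) \<Rightarrow> 'a poly \<Rightarrow> 'a poly \<Rightarrow> 'g with_top" where
  "root_val v F f =
     closure_val v (poly (map_poly to_ac f) (SOME \<theta>. poly (map_poly to_ac F) \<theta> = 0))"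

definition poly_valuation ::
    "('a::field \<Rightarrow> 'g::linordered_ab_group_add with_top) \<Rightarrow> ('a poly \<Rightarrow> 'g with_top) \<Rightarrow> bool" where
  "poly_valuation v \<mu> \<longleftrightarrow> is_valuation \<mu> \<and> (\<forall>a. \<mu> [:a:] = v a)"

section \<open>The graded algebra and key polynomials\<close>

text \<open>The graded algebra \<open>\<Oplus>\<^sub>\<alpha> P\<^sub>\<alpha> / P\<^sub>\<alpha>\<^sup>+\<close> is built as the quotient of
  \<open>\<Oplus>\<^sub>\<alpha> P\<^sub>\<alpha>\<close> by the ideal \<open>\<Oplus>\<^sub>\<alpha> P\<^sub>\<alpha>\<^sup>+\<close>; elements of \<open>\<Oplus>\<^sub>\<alpha> P\<^sub>\<alpha>\<close> are finitely supported maps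
  \<open>'g \<Rightarrow>\<^sub>0 'a poly\<close>, whose library multiplication is convolution. The index \<open>\<alpha>\<close> ranges over all
  of \<open>'g\<close>, which changes nothing since \<open>P\<^sub>\<alpha> = P\<^sub>\<alpha>\<^sup>+\<close> whenever \<open>\<alpha>\<close> is not a value of \<open>\<mu>\<close>.\<close>

definition filtration :: "('a::field poly \<Rightarrow> 'g::linordered_ab_group_add with_top) \<Rightarrow> 'g \<Rightarrow> 'a poly set" where
  "filtration \<mu> \<alpha> = {g. Fin \<alpha> \<le> \<mu> g}"

definition filtration_plus :: "('a::field poly \<Rightarrow> 'g::linordered_ab_group_add with_top) \<Rightarrow> 'g \<Rightarrow> 'a poly set" where
  "filtration_plus \<mu> \<alpha> = {g. Fin \<alpha> < \<mu> g}"

definition filtration_sum ::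
    "('a::field poly \<Rightarrow> 'g::linordered_ab_group_add with_top) \<Rightarrow> ('g \<Rightarrow>\<^sub>0 'a poly) ring" where
  "filtration_sum \<mu> =
     \<lparr>carrier = {p. \<forall>\<alpha>. Poly_Mapping.lookup p \<alpha> \<in> filtration \<mu> \<alpha>}, monoid.mult = (*), one = 1, ring.zero = 0, add = (+)\<rparr>"

definition filtration_plus_sum ::
    "('a::field poly \<Rightarrow> 'g::linordered_ab_group_add with_top) \<Rightarrow> ('g \<Rightarrow>\<^sub>0 'a poly) set" where
  "filtration_plus_sum \<mu> = {p. \<forall>\<alpha>. Poly_Mapping.lookup p \<alpha> \<in> filtration_plus \<mu> \<alpha>}"

definition graded_algebra ::
    "('a::field poly \<Rightarrow> 'g::linordered_ab_group_add with_top) \<Rightarrow> ('g \<Rightarrow>\<^sub>0 'a poly) set ring" where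
  "graded_algebra \<mu> = filtration_sum \<mu> Quot filtration_plus_sum \<mu>"

definition initial_form ::
    "('a::field poly \<Rightarrow> 'g::linordered_ab_group_add with_top) \<Rightarrow> 'a poly \<Rightarrow> ('g \<Rightarrow>\<^sub>0 'a poly) set" where
  "initial_form \<mu> g =
     (case \<mu> g of
        Fin \<alpha> \<Rightarrow> filtration_plus_sum \<mu> +>\<^bsub>filtration_sum \<mu>\<^esub> Poly_Mapping.single \<alpha> g
      | Infty \<Rightarrow> \<zero>\<^bsub>graded_algebra \<mu>\<^esub>)"

definition graded_dvd ::
    "('a::field poly \<Rightarrow> 'g::linordered_ab_group_add with_top) \<Rightarrow> 'a poly \<Rightarrow> 'a poly \<Rightarrow> bool" where
  "graded_dvd \<mu> h g \<longleftrightarrow> initial_form \<mu> h divides\<^bsub>graded_algebra \<mu>\<^esub> initial_form \<mu> g"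

definition graded_irreducible ::
    "('a::field poly \<Rightarrow> 'g::linordered_ab_group_add with_top) \<Rightarrow> 'a poly \<Rightarrow> bool" where
  "graded_irreducible \<mu> \<phi> \<longleftrightarrow>
     initial_form \<mu> \<phi> \<noteq> \<zero>\<^bsub>graded_algebra \<mu>\<^esub> \<and>
     primeideal (PIdl\<^bsub>graded_algebra \<mu>\<^esub> (initial_form \<mu> \<phi>)) (graded_algebra \<mu>)"

definition graded_minimal ::
    "('a::field poly \<Rightarrow> 'g::linordered_ab_group_add with_top) \<Rightarrow> 'a poly \<Rightarrow> bool" where
  "graded_minimal \<mu> \<phi> \<longleftrightarrow> (\<forall>f. f \<noteq> 0 \<and> degree f < degree \<phi> \<longrightarrow> \<not> graded_dvd \<mu> \<phi> f)"

definition KP :: "('a::field poly \<Rightarrow> 'g::linordered_ab_group_add with_top) \<Rightarrow> 'a poly set" where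
  "KP \<mu> = {\<phi>. monic \<phi> \<and> graded_irreducible \<mu> \<phi> \<and> graded_minimal \<mu> \<phi>}"

text \<open>A valuation with nonzero support has no key polynomials, so the two cases of the definition
  of \<open>deg(\<mu>)\<close> do not overlap. The value is meaningless if \<open>\<mu>\<close> has no key polynomials and zero support.\<close>

definition val_deg :: "('a::field poly \<Rightarrow> 'g::linordered_ab_group_add with_top) \<Rightarrow> nat" where
  "val_deg \<mu> =
     (if KP \<mu> \<noteq> {} then LEAST d. \<exists>\<phi>\<in>KP \<mu>. degree \<phi> = d
      else degree (THE G. monic G \<and> irreducible G \<and> {f. \<mu> f = Infty} = {f. G dvd f}))"

definition tset ::
    "('a::field poly \<Rightarrow> 'g::linordered_ab_group_add with_top) \<Rightarrow> ('a poly \<Rightarrow> 'g with_top) \<Rightarrow> 'a poly set" where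
  "tset \<mu> \<nu> =
     {\<phi>. monic \<phi> \<and> \<mu> \<phi> < \<nu> \<phi> \<and> (\<forall>\<psi>. monic \<psi> \<and> \<mu> \<psi> < \<nu> \<psi> \<longrightarrow> degree \<phi> \<le> degree \<psi>)}"

section \<open>Augmentations\<close>

definition expansion_coeff :: "'a::field poly \<Rightarrow> 'a poly \<Rightarrow> nat \<Rightarrow> 'a poly" where
  "expansion_coeff \<phi> f s = (f div \<phi> ^ s) mod \<phi>"

lemma expansion_coeff_degree:
  assumes "0 < degree \<phi>"
  shows "degree (expansion_coeff \<phi> f s) < degree \<phi>"
proof -
  have "\<phi> \<noteq> 0"
    using assms by auto
  then have "f div \<phi> ^ s mod \<phi> = 0 \<or> degree (f div \<phi> ^ s mod \<phi>) < degree \<phi>"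
    by (rule degree_mod_less)
  with assms show ?thesis
    by (auto simp: expansion_coeff_def)
qed

lemma expansion:
  fixes \<phi> f :: "'a::field poly"
  assumes "0 < degree \<phi>"
  shows "f = (\<Sum>s\<le>degree f. expansion_coeff \<phi> f s * \<phi> ^ s)"
proof -
  have partial: "(\<Sum>s<n. expansion_coeff \<phi> f s * \<phi> ^ s) + (f div \<phi> ^ n) * \<phi> ^ n = f" for n
  proof (induction n)
    case (Suc n)
    have "f div \<phi> ^ Suc n = (f div \<phi> ^ n) div \<phi>"
      by (metis poly_div_mult_right power_Suc2)
    then have "expansion_coeff \<phi> f n * \<phi> ^ n + (f div \<phi> ^ Suc n) * \<phi> ^ Suc n
        = ((f div \<phi> ^ n) mod \<phi> + (f div \<phi> ^ n) div \<phi> * \<phi>) * \<phi> ^ n"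
      by (simp only: expansion_coeff_def distrib_right mult.assoc power_Suc)
    also have "\<dots> = (f div \<phi> ^ n) * \<phi> ^ n"
      by (simp only: mod_div_mult_eq)
    finally show ?case
      using Suc.IH by (simp add: add.assoc)
  qed simp
  have "degree f < degree (\<phi> ^ Suc (degree f))"
    using assms by (metis One_nat_def Suc_leI degree_0 degree_power_eq lessI less_le_trans
      mult_le_mono2 mult.right_neutral not_less0)
  then have "f div \<phi> ^ Suc (degree f) = 0"
    by (rule div_poly_less)
  with partial[of "Suc (degree f)"] show ?thesis
    by (simp add: lessThan_Suc_atMost)
qed

definition augmentation ::
    "('a::field poly \<Rightarrow> 'g::linordered_ab_group_add with_top) \<Rightarrow> 'a poly \<Rightarrow> 'g with_top \<Rightarrow> 'a poly \<Rightarrow> 'g with_top" where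
  "augmentation \<mu> \<phi> \<gamma> f = Min ((\<lambda>s. \<mu> (expansion_coeff \<phi> f s) + nsmul s \<gamma>) ` {..degree f})"

text \<open>A totally ordered family without maximal element is given by an index set \<open>I\<close> in a linearly
  ordered type and a map \<open>\<rho>\<close> that is strictly monotone on \<open>I\<close>.\<close>

definition val_family ::
    "('a::field \<Rightarrow> 'g::linordered_ab_group_add with_top) \<Rightarrow> 'i::linorder set \<Rightarrow>
      ('i \<Rightarrow> 'a poly \<Rightarrow> 'g with_top) \<Rightarrow> bool" where
  "val_family v I \<rho> \<longleftrightarrow>
     I \<noteq> {} \<and> (\<forall>i\<in>I. poly_valuation v (\<rho> i)) \<and> strict_mono_on I \<rho> \<and> (\<forall>i\<in>I. \<exists>j\<in>I. i < j)"

definition stable_value ::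
    "'i::linorder set \<Rightarrow> ('i \<Rightarrow> 'a::field poly \<Rightarrow> 'g::linordered_ab_group_add with_top) \<Rightarrow>
      'a poly \<Rightarrow> 'g with_top \<Rightarrow> bool" where
  "stable_value I \<rho> f x \<longleftrightarrow> (\<exists>i\<in>I. \<rho> i f = x \<and> (\<forall>j\<in>I. i < j \<longrightarrow> \<rho> j f = x))"

definition stable ::
    "'i::linorder set \<Rightarrow> ('i \<Rightarrow> 'a::field poly \<Rightarrow> 'g::linordered_ab_group_add with_top) \<Rightarrow> 'a poly \<Rightarrow> bool" where
  "stable I \<rho> f \<longleftrightarrow> (\<exists>x. stable_value I \<rho> f x)"

definition limit_val ::
    "'i::linorder set \<Rightarrow> ('i \<Rightarrow> 'a::field poly \<Rightarrow> 'g::linordered_ab_group_add with_top) \<Rightarrow>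
      'a poly \<Rightarrow> 'g with_top" where
  "limit_val I \<rho> f = (THE x. stable_value I \<rho> f x)"

definition KP_inf ::
    "'i::linorder set \<Rightarrow> ('i \<Rightarrow> 'a::field poly \<Rightarrow> 'g::linordered_ab_group_add with_top) \<Rightarrow> 'a poly set" where
  "KP_inf I \<rho> =
     {\<phi>. monic \<phi> \<and> \<not> stable I \<rho> \<phi> \<and> (\<forall>\<psi>. monic \<psi> \<and> \<not> stable I \<rho> \<psi> \<longrightarrow> degree \<phi> \<le> degree \<psi>)}"

definition deg_inf ::
    "'i::linorder set \<Rightarrow> ('i \<Rightarrow> 'a::field poly \<Rightarrow> 'g::linordered_ab_group_add with_top) \<Rightarrow> enat" where
  "deg_inf I \<rho> = (INF \<phi>\<in>KP_inf I \<rho>. enat (degree \<phi>))"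

definition eventual_deg ::
    "'i::linorder set \<Rightarrow> ('i \<Rightarrow> 'a::field poly \<Rightarrow> 'g::linordered_ab_group_add with_top) \<Rightarrow> nat \<Rightarrow> bool" where
  "eventual_deg I \<rho> d \<longleftrightarrow> (\<exists>i\<in>I. \<forall>j\<in>I. i \<le> j \<longrightarrow> val_deg (\<rho> j) = d)"

definition fam_deg ::
    "'i::linorder set \<Rightarrow> ('i \<Rightarrow> 'a::field poly \<Rightarrow> 'g::linordered_ab_group_add with_top) \<Rightarrow> nat" where
  "fam_deg I \<rho> = (THE d. eventual_deg I \<rho> d)"

definition essential_continuous_family ::
    "('a::field \<Rightarrow> 'g::linordered_ab_group_add with_top) \<Rightarrow> 'i::linorder set \<Rightarrow>
      ('i \<Rightarrow> 'a poly \<Rightarrow> 'g with_top) \<Rightarrow> bool" where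
  "essential_continuous_family v I \<rho> \<longleftrightarrow>
     val_family v I \<rho> \<and> (\<exists>d. eventual_deg I \<rho> d) \<and>
     enat (fam_deg I \<rho>) < deg_inf I \<rho> \<and> deg_inf I \<rho> < \<infinity>"

section \<open>MLV chains\<close>

datatype ('i, 'w) step_kind =
    Ordinary
  | Limit "'i set" "'i \<Rightarrow> 'w"

text \<open>\<open>mlv_step v \<mu> \<phi> k \<phi>' \<gamma>' \<mu>'\<close>: the step from \<open>\<mu>\<close> (with chosen key polynomial \<open>\<phi>\<close>) to \<open>\<mu>'\<close>,
  the arrow being labelled \<open>\<phi>', \<gamma>'\<close>.\<close>

fun mlv_step ::
    "('a::field \<Rightarrow> 'g::linordered_ab_group_add with_top) \<Rightarrow> ('a poly \<Rightarrow> 'g with_top) \<Rightarrow> 'a poly \<Rightarrow>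
      ('i::linorder, 'a poly \<Rightarrow> 'g with_top) step_kind \<Rightarrow> 'a poly \<Rightarrow> 'g with_top \<Rightarrow> ('a poly \<Rightarrow> 'g with_top) \<Rightarrow> bool" where
  "mlv_step v \<mu> \<phi> Ordinary \<phi>' \<gamma>' \<mu>' \<longleftrightarrow>
     \<phi>' \<in> KP \<mu> \<and> \<mu> \<phi>' < \<gamma>' \<and> \<mu>' = augmentation \<mu> \<phi>' \<gamma>' \<and> val_deg \<mu> < val_deg \<mu>'"
| "mlv_step v \<mu> \<phi> (Limit I \<rho>) \<phi>' \<gamma>' \<mu>' \<longleftrightarrow>
     essential_continuous_family v I \<rho> \<and>
     (\<exists>i\<^sub>0\<in>I. \<rho> i\<^sub>0 = \<mu> \<and> (\<forall>i\<in>I. i\<^sub>0 \<le> i)) \<and> val_deg \<mu> = fam_deg I \<rho> \<and>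
     \<phi>' \<in> KP_inf I \<rho> \<and> (\<forall>i\<in>I. \<rho> i \<phi>' < \<gamma>') \<and> \<mu>' = augmentation (limit_val I \<rho>) \<phi>' \<gamma>' \<and>
     \<phi> \<notin> tset \<mu> \<mu>'"

text \<open>The chain has the valuations \<open>\<mu> 0, \<dots>, \<mu> s\<close>; the step from \<open>\<mu> n\<close> to \<open>\<mu> (Suc n)\<close> is of kind
  \<open>k n\<close> and is labelled \<open>\<phi> (Suc n), \<gamma> (Suc n)\<close>.\<close>

definition mlv_chain ::
    "('a::field \<Rightarrow> 'g::linordered_ab_group_add with_top) \<Rightarrow> ('a poly \<Rightarrow> 'g with_top) \<Rightarrow> nat \<Rightarrow>
      (nat \<Rightarrow> 'a poly \<Rightarrow> 'g with_top) \<Rightarrow> (nat \<Rightarrow> 'a poly) \<Rightarrow> (nat \<Rightarrow> 'g with_top) \<Rightarrow>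
      (nat \<Rightarrow> ('i::linorder, 'a poly \<Rightarrow> 'g with_top) step_kind) \<Rightarrow> bool" where
  "mlv_chain v \<nu> s \<mu> \<phi> \<gamma> k \<longleftrightarrow>
     (\<forall>n\<le>s. poly_valuation v (\<mu> n)) \<and>
     val_deg (\<mu> 0) = 1 \<and> \<phi> 0 \<in> KP (\<mu> 0) \<and> degree (\<phi> 0) = 1 \<and> \<gamma> 0 = \<mu> 0 (\<phi> 0) \<and>
     (\<forall>n<s. mlv_step v (\<mu> n) (\<phi> n) (k n) (\<phi> (Suc n)) (\<gamma> (Suc n)) (\<mu> (Suc n))) \<and>
     \<mu> s = \<nu>"

section \<open>Okutsu frames\<close>

text \<open>Division by \<open>degree g > 0\<close> in the divisible hull, with \<open>Infty\<close> divided by \<open>degree g\<close> equal to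
  \<open>Infty\<close>.\<close>

definition wt :: "('a::field \<Rightarrow> 'g::linordered_ab_group_add with_top) \<Rightarrow> 'a poly \<Rightarrow> 'a poly \<Rightarrow> 'g with_top" where
  "wt v F g = (THE q. nsmul (degree g) q = root_val v F g)"

definition weight_set ::
    "('a::field \<Rightarrow> 'g::linordered_ab_group_add with_top) \<Rightarrow> 'a poly \<Rightarrow> nat \<Rightarrow> 'g with_top set" where
  "weight_set v F m = {wt v F g | g. monic g \<and> 0 < degree g \<and> degree g < m}"

definition has_max :: "'b::linorder set \<Rightarrow> bool" where
  "has_max W \<longleftrightarrow> (\<exists>w\<in>W. \<forall>w'\<in>W. w' \<le> w)"

text \<open>The definition includes the conditions (OF1), (OF2), (OF3), which are its last three
  conjuncts. In (OF2), the relation \<open>v\<^sub>F(\<phi>) < v\<^sub>F(\<phi>')\<close> is a total order on a set iff \<open>v\<^sub>F\<close> is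
  injective on that set.\<close>

definition okutsu_frame ::
    "('a::field \<Rightarrow> 'g::linordered_ab_group_add with_top) \<Rightarrow> 'a poly \<Rightarrow> 'a poly set list \<Rightarrow> bool" where
  "okutsu_frame v F \<Phi> \<longleftrightarrow>
     (\<exists>r m. length \<Phi> = r + 2 \<and> \<Phi> ! (r + 1) = {F} \<and>
       (\<forall>l\<le>r + 1. \<Phi> ! l \<noteq> {} \<and> (\<forall>\<phi>\<in>\<Phi> ! l. monic \<phi> \<and> irreducible \<phi> \<and> degree \<phi> = m l)) \<and>
       m 0 = 1 \<and> (\<forall>l\<le>r. m l < m (l + 1)) \<and> m (r + 1) = degree F \<and>
       (\<forall>l\<le>r. \<forall>g. monic g \<and> 0 < degree g \<and> degree g < m (l + 1) \<longrightarrow>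
          (\<exists>\<phi>\<in>\<Phi> ! l. wt v F g \<le> wt v F \<phi>)) \<and>
       (\<forall>l\<le>r. has_max (weight_set v F (m (l + 1))) \<longrightarrow> card (\<Phi> ! l) = 1) \<and>
       (\<forall>l\<le>r. \<not> has_max (weight_set v F (m (l + 1))) \<longrightarrow> inj_on (root_val v F) (\<Phi> ! l)) \<and>
       (\<forall>l\<le>r. \<forall>\<phi>\<in>\<Phi> ! l. \<forall>\<psi>\<in>\<Phi> ! (l + 1). wt v F \<phi> < wt v F \<psi>))"

text \<open>The sets attached to an MLV chain: \<open>\<chi>\<close> are the polynomials defining the family of a limit step.\<close>

fun frame_set ::
    "'a::field poly \<Rightarrow> ('i, 'w) step_kind \<Rightarrow> ('i \<Rightarrow> 'a poly) \<Rightarrow> 'a poly set" where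
  "frame_set \<phi> Ordinary \<chi> = {\<phi>}"
| "frame_set \<phi> (Limit I \<rho>) \<chi> = \<chi> ` I"

end

(* Everything rests on one bound: if phi is mu-minimal and f is monic, then expanding
   f^(deg phi), whose phi-expansion has leading term phi^(deg f), gives
   deg phi * mu f <= deg f * mu phi. Hence key polynomials of mu have maximal weight among all
   monic polynomials. Along the chain v_F agrees with mu_l (or with the stable value of the family
   A_l) in degrees below deg phi_(l+1), so the bound for mu_l, or for a valuation far enough in A_l,
   is the Okutsu property. A family A_l has no last element, hence the values v_F(chi_i)
   strictly increase and no weight is maximal.

   The degrees m_l are strictly increasing because phi_(l+1) is a key polynomial of minimal degree
   of mu_(l+1); the graded algebra enters only through the criterion that, when the support is zero,
   phi is a key polynomial iff mu is compatible with phi-expansions and f |-> mu (f mod phi) is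
   multiplicative. *)

theory Submission
  imports Defs
begin

text \<open>The chain presents \<open>\<phi> (Suc n)\<close> as a key polynomial of
  \<open>\<mu> n\<close>, or as an unstable polynomial of least degree; the frame needs it, for
  \<open>n < r\<close>, as a key polynomial of \<open>\<mu> (Suc n)\<close>. Primality of an initial
  form has no evident reason to survive, because the graded algebra itself changes with the
  valuation. The criterion turns it into a condition on values in degrees below
  \<open>degree \<phi>\<close>, where an ordinary augmentation changes nothing. At a limit step the
  same condition follows from instability: a wrong value of \<open>a * b mod \<phi>\<close> would
  fix the value of a multiple of \<open>\<phi>\<close>, and so of \<open>\<phi>\<close>, along the
  family. The zero support that the criterion requires comes from the other end: a valuation from
  which a further step starts has some key polynomial. Condition (OF3) compares values of
  \<open>v_F\<close> that are known only as lower bounds on the right-hand side. The quotient of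
  \<open>\<gamma> (Suc n)\<close> by \<open>degree (\<phi> (Suc n))\<close> is put between the two
  weights: strictly above those of the set at \<open>n\<close>, at most those of the next
  set.\<close>

instance with_top :: (linordered_ab_group_add) ordered_comm_monoid_add
proof
  fix a b c :: "'a with_top"
  assume "a \<le> b"
  then show "c + a \<le> c + b"
    by (cases a; cases b; cases c) auto
qed

section \<open>Arithmetic in an ordered group with a largest element\<close>

lemma Fin_less_iff [simp]: "Fin a < Fin b \<longleftrightarrow> a < b"
  by (auto simp: less_with_top_def)

lemma Fin_less_Infty [simp]: "Fin a < Infty"
  by (simp add: less_with_top_def)

lemma Infty_not_less [simp]: "\<not> Infty < x"
  by (simp add: less_with_top_def)

lemma Infty_le_iff [simp]: "Infty \<le> x \<longleftrightarrow> x = Infty"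
  by (cases x) auto

lemma less_Infty_iff [simp]: "x < Infty \<longleftrightarrow> x \<noteq> Infty"
  by (cases x) auto

lemma add_Infty [simp]: "x + Infty = Infty" "Infty + x = Infty"
  by (cases x; simp)+

lemma add_eq_Infty_iff [simp]: "x + y = Infty \<longleftrightarrow> x = Infty \<or> y = Infty"
  by (cases x; cases y) auto

lemma not_Infty_eq: "x \<noteq> Infty \<longleftrightarrow> (\<exists>a. x = Fin a)"
  by (cases x) auto

text \<open>Strictness is lost exactly when \<open>Infty\<close> is added to both sides. The
  hypothesis \<open>x < y\<close> already makes \<open>x\<close> finite, so only \<open>z\<close>
  has to be assumed finite.\<close>

lemma with_top_add_less_le_mono:
  fixes x y z :: "'g::linordered_ab_group_add with_top"
  assumes "x < y" and "z \<le> t" and "z \<noteq> Infty"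
  shows "x + z < y + t"
  using assms by (cases x; cases y; cases z; cases t) (auto intro: add_less_le_mono)

lemma nsmul_Fin: "nsmul n (Fin a) = Fin (nsmul n a)"
  by (induction n) (auto simp: zero_with_top_def)

lemma nsmul_Infty: "0 < n \<Longrightarrow> nsmul n Infty = Infty"
  by (cases n) auto

lemma nsmul_add_left: "nsmul (m + n) x = nsmul m x + nsmul n x"
  by (induction m) (auto simp: add.assoc)

lemma nsmul_mult: "nsmul (m * n) x = nsmul m (nsmul n x)"
  by (induction m) (auto simp: nsmul_add_left)

lemma nsmul_mono: "x \<le> y \<Longrightarrow> nsmul n x \<le> nsmul n (y :: 'b::ordered_comm_monoid_add)"
  by (induction n) (auto intro: add_mono)

lemma nsmul_strict_mono:
  fixes x y :: "'g::linordered_ab_group_add with_top"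
  assumes "x < y" and "0 < n"
  shows "nsmul n x < nsmul n y"
  using assms(2)
proof (induction n rule: nat_induct_non_zero)
  case 1
  with assms show ?case by simp
next
  case (Suc n)
  have "nsmul n x \<noteq> Infty"
    using Suc.IH by auto
  then show ?case
    using with_top_add_less_le_mono[OF assms(1)] Suc.IH by fastforce
qed

lemma nsmul_le_cancel:
  fixes x y :: "'g::linordered_ab_group_add with_top"
  assumes "nsmul n x \<le> nsmul n y" and "0 < n"
  shows "x \<le> y"
  using nsmul_strict_mono[of y x n] assms by (meson leD leI)

section \<open>Valuations\<close>

context
  fixes w :: "'r::comm_ring_1 \<Rightarrow> 'g::linordered_ab_group_add with_top"
  assumes val: "is_valuation w"
begin

lemma val_0: "w 0 = Infty"
  and val_1: "w 1 = 0"
  and val_mult: "w (x * y) = w x + w y"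
  and val_add: "min (w x) (w y) \<le> w (x + y)"
  using val by (auto simp: is_valuation_def)

lemma val_power: "w (x ^ n) = nsmul n (w x)"
  by (induction n) (auto simp: val_1 val_mult)

lemma val_uminus: "w (- x) = w x"
proof -
  \<comment> \<open>The square of -1 is 1, and an ordered group has no torsion, so -1 has value
    0.\<close>
  have "w (- 1) + w (- 1) = Fin 0"
    by (metis val_1 val_mult mult_minus1 minus_minus zero_with_top_def)
  then have "w (- 1) = 0"
    by (cases "w (- 1)") (auto simp: zero_with_top_def)
  then show ?thesis
    by (metis add_0 mult_minus1 val_mult)
qed

lemma val_minus_commute: "w (x - y) = w (y - x)"
  by (metis minus_diff_eq val_uminus)

lemma val_add_le: "c \<le> w x \<Longrightarrow> c \<le> w y \<Longrightarrow> c \<le> w (x + y)"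
  using val_add[of x y] by (meson min.boundedI order_trans)

lemma val_diff_le: "c \<le> w x \<Longrightarrow> c \<le> w y \<Longrightarrow> c \<le> w (x - y)"
  using val_add_le[of c x "- y"] by (simp add: val_uminus)

lemma val_add_less: "c < w x \<Longrightarrow> c < w y \<Longrightarrow> c < w (x + y)"
  using val_add[of x y] by (meson min_less_iff_conj order_less_le_trans)

lemma val_diff_less: "c < w x \<Longrightarrow> c < w y \<Longrightarrow> c < w (x - y)"
  using val_add_less[of c x "- y"] by (simp add: val_uminus)

lemma val_sum_less: "c < Infty \<Longrightarrow> (\<And>x. x \<in> A \<Longrightarrow> c < w (f x)) \<Longrightarrow> c < w (sum f A)"
  by (induction A rule: infinite_finite_induct) (auto simp: val_0 val_add_less)

lemma val_sum_le: "(\<And>x. x \<in> A \<Longrightarrow> c \<le> w (f x)) \<Longrightarrow> c \<le> w (sum f A)"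
  by (induction A rule: infinite_finite_induct) (auto simp: val_0 val_add_le)

lemma val_add_eq_min:
  assumes "w x \<noteq> w y"
  shows "w (x + y) = min (w x) (w y)"
proof -
  have *: "w (x + y) = w x" if "w x < w y" for x y
  proof (rule antisym)
    show "w x \<le> w (x + y)"
      using that by (intro val_add_le) auto
    show "w (x + y) \<le> w x"
      using val_diff_less[of "w x" "x + y" y] that by (auto simp: not_less[symmetric])
  qed
  show ?thesis
    using *[of x y] *[of y x] assms by (cases "w x < w y") (auto simp: min_def add.commute)
qed

lemma val_diff_eq_min: "w x \<noteq> w y \<Longrightarrow> w (x - y) = min (w x) (w y)"
  using val_add_eq_min[of x "- y"] by (simp add: val_uminus)

end

section \<open>The graded algebra\<close>

text \<open>The exponents form a group, so the second index is determined as \<open>k - a\<close>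
  and the convolution collapses to a finite sum over the keys of \<open>p\<close>.\<close>

lemma lookup_mult_keys:
  fixes p q :: "'g::ab_group_add \<Rightarrow>\<^sub>0 'b::semiring_0"
  shows "Poly_Mapping.lookup (p * q) k =
    (\<Sum>a\<in>Poly_Mapping.keys p. Poly_Mapping.lookup p a * Poly_Mapping.lookup q (k - a))"
proof -
  have inner: "(\<Sum>b. Poly_Mapping.lookup q b when k = a + b) = Poly_Mapping.lookup q (k - a)" for a
  proof -
    have eq: "(\<lambda>b. Poly_Mapping.lookup q b when k = a + b)
        = (\<lambda>b. Poly_Mapping.lookup q b when b = k - a)"
      by (auto simp: fun_eq_iff when_def)
    show ?thesis
      unfolding eq by simp
  qed
  show ?thesis
    unfolding lookup_mult inner
    by (rule Sum_any.expand_superset) (auto simp: in_keys_iff)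
qed

lemma lookup_single_mult:
  fixes q :: "'g::ab_group_add \<Rightarrow>\<^sub>0 'b::semiring_0"
  shows "Poly_Mapping.lookup (Poly_Mapping.single a x * q) k = x * Poly_Mapping.lookup q (k - a)"
  by (cases "x = 0") (auto simp: lookup_mult_keys)

text \<open>Kept separate from the carrier of \<open>filtration_sum\<close> because it is also
  applied to the valuation \<open>f \<mapsto> \<mu> (f mod \<phi>)\<close>, for which no graded ring
  is set up.\<close>

definition filtered ::
    "('b::comm_ring_1 \<Rightarrow> 'g::linordered_ab_group_add with_top) \<Rightarrow> ('g \<Rightarrow>\<^sub>0 'b) \<Rightarrow> bool" where
  "filtered w p \<longleftrightarrow> (\<forall>\<alpha>. Fin \<alpha> \<le> w (Poly_Mapping.lookup p \<alpha>))"

definition filtered_plus ::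
    "('b::comm_ring_1 \<Rightarrow> 'g::linordered_ab_group_add with_top) \<Rightarrow> ('g \<Rightarrow>\<^sub>0 'b) \<Rightarrow> bool" where
  "filtered_plus w p \<longleftrightarrow> (\<forall>\<alpha>. Fin \<alpha> < w (Poly_Mapping.lookup p \<alpha>))"

lemma filtered_mult:
  assumes "is_valuation w" and "filtered w p" and "filtered w q"
  shows "filtered w (p * q)"
  unfolding filtered_def lookup_mult_keys
proof (intro allI val_sum_le[OF assms(1)])
  fix \<alpha> a
  have "Fin a + Fin (\<alpha> - a) \<le> w (Poly_Mapping.lookup p a) + w (Poly_Mapping.lookup q (\<alpha> - a))"
    using assms unfolding filtered_def by (blast intro: add_mono)
  then show "Fin \<alpha> \<le> w (Poly_Mapping.lookup p a * Poly_Mapping.lookup q (\<alpha> - a))"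
    by (simp add: val_mult[OF assms(1)])
qed

lemma filtered_plus_mult:
  assumes "is_valuation w" and "filtered_plus w p" and "filtered w q"
  shows "filtered_plus w (p * q)"
  unfolding filtered_plus_def lookup_mult_keys
proof (intro allI val_sum_less[OF assms(1)])
  fix \<alpha> a
  have "Fin a + Fin (\<alpha> - a) < w (Poly_Mapping.lookup p a) + w (Poly_Mapping.lookup q (\<alpha> - a))"
    using assms unfolding filtered_plus_def filtered_def
    by (intro with_top_add_less_le_mono) auto
  then show "Fin \<alpha> < w (Poly_Mapping.lookup p a * Poly_Mapping.lookup q (\<alpha> - a))"
    by (simp add: val_mult[OF assms(1)])
qed simp

text \<open>The lowest components of \<open>p\<close> and \<open>q\<close> that do not lie in the ideal contribute a product of
  exact value to the corresponding component of \<open>p * q\<close>.\<close>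

lemma filtered_plus_prime:
  assumes w: "is_valuation w" and p: "filtered w p" and q: "filtered w q"
    and pq: "filtered_plus w (p * q)"
  shows "filtered_plus w p \<or> filtered_plus w q"
proof (rule ccontr)
  let ?lp = "Poly_Mapping.lookup p" and ?lq = "Poly_Mapping.lookup q"
  assume neg: "\<not> ?thesis"
  have least: "\<exists>a. w (Poly_Mapping.lookup x a) = Fin a \<and>
      (\<forall>b<a. Fin b < w (Poly_Mapping.lookup x b))"
    if x: "filtered w x" "\<not> filtered_plus w x" for x
  proof -
    define S where "S = {a. w (Poly_Mapping.lookup x a) = Fin a}"
    have "S \<subseteq> Poly_Mapping.keys x"
      using val_0[OF w] by (auto simp: S_def in_keys_iff)
    then have "finite S"
      by (rule finite_subset) simp
    moreover have "S \<noteq> {}"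
      using x unfolding filtered_def filtered_plus_def S_def
      by (metis (mono_tags, lifting) empty_iff mem_Collect_eq order_le_less)
    ultimately have "Min S \<in> S" "\<forall>b\<in>S. Min S \<le> b"
      by auto
    then show ?thesis
      using x(1) unfolding filtered_def S_def
      by (metis (mono_tags, lifting) mem_Collect_eq not_less order_le_less)
  qed
  obtain a where a: "w (?lp a) = Fin a" "\<And>b. b < a \<Longrightarrow> Fin b < w (?lp b)"
    using least[OF p] neg by blast
  obtain b where b: "w (?lq b) = Fin b" "\<And>c. c < b \<Longrightarrow> Fin c < w (?lq c)"
    using least[OF q] neg by blast
  have "a \<in> Poly_Mapping.keys p"
    using a(1) val_0[OF w] by (auto simp: in_keys_iff)
  then have split: "Poly_Mapping.lookup (p * q) (a + b) = ?lp a * ?lq b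
      + (\<Sum>c\<in>Poly_Mapping.keys p - {a}. ?lp c * ?lq (a + b - c))"
    by (simp add: lookup_mult_keys sum.remove[of _ a])
  have "Fin (a + b) < w (\<Sum>c\<in>Poly_Mapping.keys p - {a}. ?lp c * ?lq (a + b - c))"
  proof (intro val_sum_less[OF w])
    fix c assume "c \<in> Poly_Mapping.keys p - {a}"
    \<comment> \<open>Below \<open>a\<close> the component of \<open>p\<close> is strict; above
      \<open>a\<close> the matching index \<open>a + b - c\<close> is below \<open>b\<close>, where
      the component of \<open>q\<close> is strict.\<close>
    then consider "c < a" | "a < c" by force
    then have "Fin c + Fin (a + b - c) < w (?lp c) + w (?lq (a + b - c))"
    proof cases
      case 1
      then show ?thesis
        using q a(2) unfolding filtered_def by (intro with_top_add_less_le_mono) auto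
    next
      case 2
      then have "Fin (a + b - c) < w (?lq (a + b - c))"
        by (intro b(2)) (simp add: algebra_simps)
      then have "Fin (a + b - c) + Fin c < w (?lq (a + b - c)) + w (?lp c)"
        using p unfolding filtered_def by (intro with_top_add_less_le_mono) auto
      then show ?thesis
        by (simp only: add.commute)
    qed
    then show "Fin (a + b) < w (?lp c * ?lq (a + b - c))"
      by (simp add: val_mult[OF w])
  qed simp
  moreover have "w (?lp a * ?lq b) = Fin (a + b)"
    by (simp add: val_mult[OF w] a b)
  ultimately have "w (Poly_Mapping.lookup (p * q) (a + b)) = Fin (a + b)"
    unfolding split by (subst val_add_eq_min[OF w]) auto
  then show False
    using pq unfolding filtered_plus_def by (metis less_irrefl)
qed

section \<open>The quotient ring and divisibility of initial forms\<close>

lemma carrier_filtration_sum: "p \<in> carrier (filtration_sum \<mu>) \<longleftrightarrow> filtered \<mu> p"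
  by (simp add: filtration_sum_def filtration_def filtered_def)

lemma filtration_plus_sum_iff: "p \<in> filtration_plus_sum \<mu> \<longleftrightarrow> filtered_plus \<mu> p"
  by (simp add: filtration_plus_sum_def filtration_plus_def filtered_plus_def)

lemma filtered_plusD: "filtered_plus w p \<Longrightarrow> filtered w p"
  by (auto simp: filtered_def filtered_plus_def intro: less_imp_le)

lemma filtered_single:
  "is_valuation w \<Longrightarrow> Fin a \<le> w x \<Longrightarrow> filtered w (Poly_Mapping.single a x)"
  by (auto simp: filtered_def lookup_single when_def val_0)

context
  fixes \<mu> :: "'a::field poly \<Rightarrow> 'g::linordered_ab_group_add with_top"
  assumes val: "is_valuation \<mu>"
begin

lemma cring_filtration_sum: "cring (filtration_sum \<mu>)"
proof (rule cringI)
  show "abelian_group (filtration_sum \<mu>)"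
  proof (rule abelian_groupI)
    fix x assume "x \<in> carrier (filtration_sum \<mu>)"
    then show "\<exists>y\<in>carrier (filtration_sum \<mu>). y \<oplus>\<^bsub>filtration_sum \<mu>\<^esub> x = \<zero>\<^bsub>filtration_sum \<mu>\<^esub>"
      by (intro bexI[of _ "- x"])
        (auto simp: filtration_sum_def filtration_def val_uminus[OF val])
  qed (auto simp: filtration_sum_def filtration_def lookup_add val_0[OF val] algebra_simps
      intro: val_add_le[OF val])
  show "Group.comm_monoid (filtration_sum \<mu>)"
  proof (rule Group.comm_monoidI)
    fix x y assume "x \<in> carrier (filtration_sum \<mu>)" "y \<in> carrier (filtration_sum \<mu>)"
    then show "x \<otimes>\<^bsub>filtration_sum \<mu>\<^esub> y \<in> carrier (filtration_sum \<mu>)"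
      using filtered_mult[OF val, of x y]
      by (simp add: carrier_filtration_sum) (simp add: filtration_sum_def)
  next
    show "\<one>\<^bsub>filtration_sum \<mu>\<^esub> \<in> carrier (filtration_sum \<mu>)"
      by (auto simp: filtration_sum_def filtration_def lookup_one when_def val_0[OF val]
          val_1[OF val] zero_with_top_def)
  qed (auto simp: filtration_sum_def algebra_simps)
qed (auto simp: filtration_sum_def algebra_simps)

lemma ideal_filtration_plus_sum: "ideal (filtration_plus_sum \<mu>) (filtration_sum \<mu>)"
proof (rule idealI)
  interpret cring "filtration_sum \<mu>"
    by (rule cring_filtration_sum)
  show "ring (filtration_sum \<mu>)"
    by (rule ring_axioms)
  have inv: "\<ominus>\<^bsub>filtration_sum \<mu>\<^esub> x = - x" if "x \<in> carrier (filtration_sum \<mu>)" for x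
  proof (rule sum_zero_eq_neg[symmetric, OF _ that])
    show "- x \<in> carrier (filtration_sum \<mu>)"
      using that by (auto simp: filtration_sum_def filtration_def val_uminus[OF val])
  qed (auto simp: filtration_sum_def)
  show "subgroup (filtration_plus_sum \<mu>) (add_monoid (filtration_sum \<mu>))"
  proof (rule group.subgroupI[OF a_group])
    show "filtration_plus_sum \<mu> \<subseteq> carrier (add_monoid (filtration_sum \<mu>))"
      by (auto simp: carrier_filtration_sum filtration_plus_sum_iff filtered_plusD)
    have "0 \<in> filtration_plus_sum \<mu>"
      by (simp add: filtration_plus_sum_def filtration_plus_def val_0[OF val])
    then show "filtration_plus_sum \<mu> \<noteq> {}"
      by blast
  next
    fix a assume a: "a \<in> filtration_plus_sum \<mu>"
    then have "a \<in> carrier (filtration_sum \<mu>)"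
      by (auto simp: carrier_filtration_sum filtration_plus_sum_iff filtered_plusD)
    then have "inv\<^bsub>add_monoid (filtration_sum \<mu>)\<^esub> a = - a"
      using inv by (simp add: a_inv_def)
    then show "inv\<^bsub>add_monoid (filtration_sum \<mu>)\<^esub> a \<in> filtration_plus_sum \<mu>"
      using a by (auto simp: filtration_plus_sum_def filtration_plus_def val_uminus[OF val])
  next
    fix a b assume "a \<in> filtration_plus_sum \<mu>" "b \<in> filtration_plus_sum \<mu>"
    then show "a \<otimes>\<^bsub>add_monoid (filtration_sum \<mu>)\<^esub> b \<in> filtration_plus_sum \<mu>"
      by (auto simp: filtration_plus_sum_def filtration_plus_def filtration_sum_def lookup_add
          val_add_less[OF val])
  qed
next
  fix a x assume "a \<in> filtration_plus_sum \<mu>" "x \<in> carrier (filtration_sum \<mu>)"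
  then have "filtered_plus \<mu> (a * x)"
    by (intro filtered_plus_mult[OF val])
      (auto simp: carrier_filtration_sum filtration_plus_sum_iff)
  then show "x \<otimes>\<^bsub>filtration_sum \<mu>\<^esub> a \<in> filtration_plus_sum \<mu>"
    and "a \<otimes>\<^bsub>filtration_sum \<mu>\<^esub> x \<in> filtration_plus_sum \<mu>"
    by (auto simp: filtration_plus_sum_iff filtration_sum_def mult.commute)
qed

interpretation R: cring "filtration_sum \<mu>"
  by (rule cring_filtration_sum)

interpretation J: ideal "filtration_plus_sum \<mu>" "filtration_sum \<mu>"
  by (rule ideal_filtration_plus_sum)

lemma cring_graded_algebra: "cring (graded_algebra \<mu>)"
  unfolding graded_algebra_def by (rule J.quotient_is_cring[OF cring_filtration_sum])

interpretation G: cring "graded_algebra \<mu>"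
  by (rule cring_graded_algebra)

private abbreviation coset where "coset p \<equiv> filtration_plus_sum \<mu> +>\<^bsub>filtration_sum \<mu>\<^esub> p"

lemma coset_eq_iff:
  assumes "filtered \<mu> p" and "filtered \<mu> q"
  shows "coset p = coset q \<longleftrightarrow> filtered_plus \<mu> (p - q)"
proof -
  have c: "p \<in> carrier (filtration_sum \<mu>)" "q \<in> carrier (filtration_sum \<mu>)"
    using assms by (auto simp: carrier_filtration_sum)
  have "- q \<in> carrier (filtration_sum \<mu>)"
    using c by (auto simp: filtration_sum_def filtration_def val_uminus[OF val])
  then have "\<ominus>\<^bsub>filtration_sum \<mu>\<^esub> q = - q"
    using c by (intro R.sum_zero_eq_neg[symmetric]) (auto simp: filtration_sum_def)
  then have "p \<ominus>\<^bsub>filtration_sum \<mu>\<^esub> q = p - q"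
    by (simp add: a_minus_def) (simp add: filtration_sum_def)
  then show ?thesis
    using R.quotient_eq_iff_same_a_r_cos[OF ideal_filtration_plus_sum c]
    by (simp add: filtration_plus_sum_iff)
qed

lemma coset_mult:
  assumes "filtered \<mu> p" and "filtered \<mu> q"
  shows "coset p \<otimes>\<^bsub>graded_algebra \<mu>\<^esub> coset q = coset (p * q)"
  using J.rcoset_mult_add[of p q] assms
  by (simp add: carrier_filtration_sum graded_algebra_def FactRing_def)
    (simp add: filtration_sum_def)

lemma carrier_graded_algebra: "carrier (graded_algebra \<mu>) = {coset p | p. filtered \<mu> p}"
  by (auto simp: graded_algebra_def FactRing_def A_RCOSETS_def' carrier_filtration_sum)

lemma initial_form_Fin: "\<mu> g = Fin \<alpha> \<Longrightarrow> initial_form \<mu> g = coset (Poly_Mapping.single \<alpha> g)"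
  by (simp add: initial_form_def)

lemma initial_form_carrier: "initial_form \<mu> g \<in> carrier (graded_algebra \<mu>)"
proof (cases "\<mu> g")
  case (Fin \<alpha>)
  then show ?thesis
    using filtered_single[OF val, of \<alpha> g]
    by (auto simp: initial_form_Fin carrier_graded_algebra)
qed (simp add: initial_form_def)

lemma initial_form_mult:
  assumes "\<mu> f = Fin \<alpha>" and "\<mu> g = Fin \<beta>"
  shows "initial_form \<mu> (f * g) = initial_form \<mu> f \<otimes>\<^bsub>graded_algebra \<mu>\<^esub> initial_form \<mu> g"
proof -
  have "\<mu> (f * g) = Fin (\<alpha> + \<beta>)"
    by (simp add: val_mult[OF val] assms)
  then show ?thesis
    using assms
    by (simp add: initial_form_Fin coset_mult filtered_single[OF val] mult_single)
qed

text \<open>Both initial forms are homogeneous, so a quotient may be replaced by its component of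
  index \<open>\<alpha> - \<beta>\<close>, which is the polynomial \<open>q\<close>. Conversely the
  inequality forces \<open>q * h\<close> to have value \<open>\<alpha>\<close>, so \<open>q\<close>
  has value \<open>\<alpha> - \<beta>\<close> and its initial form is a quotient.\<close>

lemma graded_dvd_iff:
  assumes h: "\<mu> h = Fin \<beta>" and g: "\<mu> g = Fin \<alpha>"
  shows "graded_dvd \<mu> h g \<longleftrightarrow> (\<exists>q. Fin \<alpha> < \<mu> (g - q * h))"
proof
  assume "graded_dvd \<mu> h g"
  then obtain Q where Q: "filtered \<mu> Q"
    "coset (Poly_Mapping.single \<alpha> g) = coset (Poly_Mapping.single \<beta> h) \<otimes>\<^bsub>graded_algebra \<mu>\<^esub> coset Q"
    unfolding graded_dvd_def factor_def carrier_graded_algebra initial_form_Fin[OF h] initial_form_Fin[OF g]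
    by blast
  have sh: "filtered \<mu> (Poly_Mapping.single \<beta> h)" "filtered \<mu> (Poly_Mapping.single \<alpha> g)"
    using h g by (auto intro: filtered_single[OF val])
  then have "filtered_plus \<mu> (Poly_Mapping.single \<alpha> g - Poly_Mapping.single \<beta> h * Q)"
    using Q by (simp add: coset_mult coset_eq_iff filtered_mult[OF val])
  then have "Fin \<alpha> < \<mu> (g - h * Poly_Mapping.lookup Q (\<alpha> - \<beta>))"
    unfolding filtered_plus_def
    by (metis lookup_minus lookup_single_eq lookup_single_mult)
  then show "\<exists>q. Fin \<alpha> < \<mu> (g - q * h)"
    by (metis mult.commute)
next
  assume "\<exists>q. Fin \<alpha> < \<mu> (g - q * h)"
  then obtain q where q: "Fin \<alpha> < \<mu> (g - q * h)" by blast
  have "\<mu> (q * h) = \<mu> (g + - (g - q * h))"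
    by simp
  also have "\<dots> = Fin \<alpha>"
    using q g by (subst val_add_eq_min[OF val]) (auto simp: val_uminus[OF val] min_def dest: leD simp del: minus_diff_eq)
  finally have qh: "\<mu> (q * h) = Fin \<alpha>" .
  then have mq: "\<mu> q = Fin (\<alpha> - \<beta>)"
    using h by (cases "\<mu> q") (auto simp: val_mult[OF val])
  have "initial_form \<mu> (q * h) = initial_form \<mu> h \<otimes>\<^bsub>graded_algebra \<mu>\<^esub> initial_form \<mu> q"
    using initial_form_mult[OF h mq] by (simp add: mult.commute)
  moreover have "initial_form \<mu> (q * h) = initial_form \<mu> g"
  proof -
    have "filtered_plus \<mu> (Poly_Mapping.single \<alpha> (q * h) - Poly_Mapping.single \<alpha> g)"
      unfolding filtered_plus_def
      using q by (auto simp: lookup_minus lookup_single when_def val_0[OF val]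
          val_minus_commute[OF val, of "q * h" g])
    then show ?thesis
      using qh g by (auto simp: initial_form_Fin coset_eq_iff filtered_single[OF val])
  qed
  ultimately show "graded_dvd \<mu> h g"
    unfolding graded_dvd_def factor_def using initial_form_carrier by force
qed

lemma initial_form_Fin_nonzero:
  assumes "\<mu> g = Fin \<alpha>"
  shows "initial_form \<mu> g \<noteq> \<zero>\<^bsub>graded_algebra \<mu>\<^esub>"
proof
  assume "initial_form \<mu> g = \<zero>\<^bsub>graded_algebra \<mu>\<^esub>"
  then have "coset (Poly_Mapping.single \<alpha> g) = coset 0"
    using R.ring_axioms J.a_rcos_const[of 0]
    by (simp add: initial_form_Fin[OF assms] graded_algebra_def FactRing_def filtration_plus_sum_iff
        filtered_plus_def val_0[OF val])
  then have "filtered_plus \<mu> (Poly_Mapping.single \<alpha> g - 0)"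
    by (intro coset_eq_iff[THEN iffD1])
      (auto simp: filtered_single[OF val] assms filtered_def[of _ 0] val_0[OF val])
  then show False
    using assms unfolding filtered_plus_def by (metis diff_zero less_irrefl lookup_single_eq)
qed

lemma graded_irreducible_dvd_mult:
  assumes "graded_irreducible \<mu> \<phi>" and "\<mu> f \<noteq> Infty" and "\<mu> g \<noteq> Infty" and "graded_dvd \<mu> \<phi> (f * g)"
  shows "graded_dvd \<mu> \<phi> f \<or> graded_dvd \<mu> \<phi> g"
proof -
  interpret primeideal "PIdl\<^bsub>graded_algebra \<mu>\<^esub> (initial_form \<mu> \<phi>)" "graded_algebra \<mu>"
    using assms(1) by (simp add: graded_irreducible_def)
  have dvd: "graded_dvd \<mu> \<phi> x \<longleftrightarrow> initial_form \<mu> x \<in> PIdl\<^bsub>graded_algebra \<mu>\<^esub> (initial_form \<mu> \<phi>)" for x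
    unfolding graded_dvd_def factor_def cgenideal_def
    using G.m_comm initial_form_carrier by auto
  show ?thesis
    using assms(2-4) I_prime[OF initial_form_carrier initial_form_carrier, of f g]
    unfolding dvd not_Infty_eq by (metis initial_form_mult)
qed

text \<open>A monic constant is 1, and its initial form generates the whole algebra, whereas a prime
  ideal is proper.\<close>

lemma graded_irreducible_degree:
  assumes "graded_irreducible \<mu> \<phi>" and "monic \<phi>"
  shows "0 < degree \<phi>"
proof (rule ccontr)
  interpret primeideal "PIdl\<^bsub>graded_algebra \<mu>\<^esub> (initial_form \<mu> \<phi>)" "graded_algebra \<mu>"
    using assms(1) by (simp add: graded_irreducible_def)
  assume "\<not> ?thesis"
  then have "\<phi> = 1"
    using assms(2) by (metis degree_eq_zeroE lead_coeff_pCons(2) monic_def neq0_conv one_pCons)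
  then have "initial_form \<mu> \<phi> = \<one>\<^bsub>graded_algebra \<mu>\<^esub>"
    by (simp add: initial_form_def val_1[OF val] zero_with_top_def)
      (simp add: graded_algebra_def FactRing_def filtration_sum_def)
  then show False
    using I_notcarr by (simp add: G.cgenideal_eq_genideal[OF G.one_closed] G.genideal_one)
qed

end

section \<open>Key polynomials\<close>

text \<open>Phrased for a single division with remainder, where \<open>q\<close> is arbitrary, so
  that statements about full expansions follow by \<open>expansion_induct\<close>.\<close>

definition val_minimal ::
    "('a::field poly \<Rightarrow> 'g::linordered_ab_group_add with_top) \<Rightarrow> 'a poly \<Rightarrow> bool" where
  "val_minimal \<mu> \<phi> \<longleftrightarrow> (\<forall>q a. degree a < degree \<phi> \<longrightarrow> \<mu> (q * \<phi> + a) = min (\<mu> (q * \<phi>)) (\<mu> a))"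

text \<open>Only polynomials of degree below \<open>degree \<phi>\<close> are evaluated, which is
  what makes the condition portable between valuations (\<open>val_prime_cong\<close>).\<close>

definition val_prime ::
    "('a::field poly \<Rightarrow> 'g::linordered_ab_group_add with_top) \<Rightarrow> 'a poly \<Rightarrow> bool" where
  "val_prime \<mu> \<phi> \<longleftrightarrow>
     (\<forall>a b. degree a < degree \<phi> \<longrightarrow> degree b < degree \<phi> \<longrightarrow> \<mu> (a * b mod \<phi>) = \<mu> a + \<mu> b)"

lemma val_minimalD:
  "val_minimal \<mu> \<phi> \<Longrightarrow> degree a < degree \<phi> \<Longrightarrow> \<mu> (q * \<phi> + a) = min (\<mu> (q * \<phi>)) (\<mu> a)"
  by (simp add: val_minimal_def)

lemma val_primeD:
  "val_prime \<mu> \<phi> \<Longrightarrow> degree a < degree \<phi> \<Longrightarrow> degree b < degree \<phi> \<Longrightarrow>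
    \<mu> (a * b mod \<phi>) = \<mu> a + \<mu> b"
  by (simp add: val_prime_def)

lemma degree_mod_less_pos:
  fixes f g :: "'a::field poly"
  assumes "0 < degree g"
  shows "degree (f mod g) < degree g"
  using degree_mod_less[of g f] assms by (cases "g = 0") auto

lemma val_minimal_div_mod:
  assumes "val_minimal \<mu> \<phi>" and "0 < degree \<phi>"
  shows "\<mu> f = min (\<mu> (f div \<phi> * \<phi>)) (\<mu> (f mod \<phi>))"
  using val_minimalD[OF assms(1) degree_mod_less_pos[OF assms(2)], of "f div \<phi>" f]
  by simp

lemma monic_power: "monic f \<Longrightarrow> monic (f ^ n)"
  by (simp add: monic_def lead_coeff_power)

lemma monic_nonzero: "monic f \<Longrightarrow> f \<noteq> 0"
  by (auto simp: monic_def)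

lemma monic_div:
  assumes "monic h" and "monic \<phi>" and "0 < degree \<phi>" and "degree \<phi> \<le> degree h"
  shows "monic (h div \<phi>)" and "degree (h div \<phi>) + degree \<phi> = degree h"
proof -
  let ?q = "h div \<phi>" and ?a = "h mod \<phi>"
  have h: "h = ?q * \<phi> + ?a"
    by simp
  have a: "degree ?a < degree h"
    using degree_mod_less_pos[OF assms(3), of h] assms(4) by simp
  have q: "?q \<noteq> 0"
    using a div_mult_mod_eq[of h \<phi>] by (metis add_0 less_irrefl mult_zero_left)
  have dqa: "degree ?a < degree (?q * \<phi>)"
    using degree_mod_less_pos[OF assms(3), of h] q monic_nonzero[OF assms(2)]
    by (simp add: degree_mult_eq)
  then have "degree h = degree (?q * \<phi>)"
    using degree_add_eq_left[OF dqa] by simp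
  then show "degree (h div \<phi>) + degree \<phi> = degree h"
    using q monic_nonzero[OF assms(2)] by (simp add: degree_mult_eq)
  have "lead_coeff h = lead_coeff (?q * \<phi>)"
    using lead_coeff_add_le[OF dqa] by (simp add: add.commute)
  then show "monic (h div \<phi>)"
    using assms(1,2) by (simp add: monic_def lead_coeff_mult)
qed

lemma monic_dvd_antisym:
  fixes p q :: "'a::field poly"
  assumes "monic p" and "monic q" and "p dvd q" and "q dvd p"
  shows "q = p"
proof -
  obtain c where c: "q = p * c"
    using assms(3) by (rule dvdE)
  have nz: "p \<noteq> 0" "c \<noteq> 0"
    using assms(1,2) c by (auto simp: monic_def)
  have "degree q \<le> degree p"
    using assms(4) nz(1) by (rule dvd_imp_degree_le)
  then have "degree c = 0"
    using nz by (simp add: c degree_mult_eq)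
  then obtain a where a: "c = [:a:]"
    by (rule degree_eq_zeroE)
  have "a = 1"
    using assms(1,2) nz by (auto simp: c a monic_def)
  then show ?thesis
    by (simp add: c a)
qed

text \<open>Write \<open>m = degree \<phi>\<close>. In the \<open>\<phi>\<close>-expansion of \<open>f ^ m\<close> the leading term is \<open>\<phi> ^ degree f\<close>, whose
  value bounds that of \<open>f ^ m\<close>.\<close>

lemma val_minimal_weight:
  assumes val: "is_valuation \<mu>" and min: "val_minimal \<mu> \<phi>" and "monic \<phi>" and "0 < degree \<phi>"
    and "monic f"
  shows "nsmul (degree \<phi>) (\<mu> f) \<le> nsmul (degree f) (\<mu> \<phi>)"
proof -
  \<comment> \<open>Only in degrees divisible by \<open>degree \<phi>\<close> is the leading
    coefficient of the expansion forced to be the constant 1, of value 0. The power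
    \<open>f ^ degree \<phi>\<close> reaches such a degree, with
    \<open>n = degree f\<close>.\<close>
  have pow: "\<mu> h \<le> nsmul n (\<mu> \<phi>)" if "monic h" "degree h = n * degree \<phi>" for h n
    using that
  proof (induction n arbitrary: h)
    case 0
    then have "h = 1"
      by (metis degree_eq_zeroE lead_coeff_pCons(2) monic_def mult_0 one_pCons)
    then show ?case
      by (simp add: val_1[OF val])
  next
    case (Suc n)
    then have "degree \<phi> \<le> degree h"
      by simp
    from monic_div[OF Suc.prems(1) assms(3,4) this] Suc.prems(2)
    have "\<mu> (h div \<phi>) \<le> nsmul n (\<mu> \<phi>)"
      by (intro Suc.IH) auto
    then have "\<mu> (h div \<phi> * \<phi>) \<le> nsmul (Suc n) (\<mu> \<phi>)"
      by (simp add: val_mult[OF val] add.commute add_left_mono)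
    then show ?case
      using val_minimal_div_mod[OF min assms(4), of h] by (simp add: min.coboundedI1)
  qed
  have "\<mu> (f ^ degree \<phi>) \<le> nsmul (degree f) (\<mu> \<phi>)"
    using assms(5) by (intro pow) (auto simp: monic_power degree_power_eq monic_nonzero)
  then show ?thesis
    by (simp add: val_power[OF val])
qed

text \<open>Used to equate the values of two key polynomials of the same degree, and to compare
  \<open>\<phi> n\<close> with \<open>\<phi> (Suc n)\<close> under \<open>\<mu> n\<close> in an
  ordinary step.\<close>

lemma val_minimal_weight_eq:
  assumes "is_valuation \<mu>" and "val_minimal \<mu> \<phi>" and "monic \<phi>" and "0 < degree \<phi>"
    and "val_minimal \<mu> \<psi>" and "monic \<psi>" and "0 < degree \<psi>"
  shows "nsmul (degree \<phi>) (\<mu> \<psi>) = nsmul (degree \<psi>) (\<mu> \<phi>)"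
  using assms by (intro antisym val_minimal_weight)

lemma monic_normalise:
  fixes f :: "'a::field poly"
  assumes "f \<noteq> 0"
  shows "monic (smult (inverse (lead_coeff f)) f)"
  using assms by (simp add: monic_def)

lemma KP_monic: "\<phi> \<in> KP \<mu> \<Longrightarrow> monic \<phi>"
  by (simp add: KP_def)

section \<open>Key polynomials described by values\<close>

context
  fixes \<mu> :: "'a::field poly \<Rightarrow> 'g::linordered_ab_group_add with_top"
  assumes val: "is_valuation \<mu>"
begin

lemma KP_degree_pos: "\<phi> \<in> KP \<mu> \<Longrightarrow> 0 < degree \<phi>"
  by (auto simp: KP_def intro: graded_irreducible_degree[OF val])

lemma KP_value_finite: "\<phi> \<in> KP \<mu> \<Longrightarrow> \<mu> \<phi> \<noteq> Infty"
  by (auto simp: KP_def graded_irreducible_def initial_form_def)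

text \<open>Cancellation needs two terms of the same finite value. A strict gain there would make
  the initial form of \<open>\<phi>\<close> divide that of \<open>a\<close>, against graded
  minimality.\<close>

lemma KP_val_minimal:
  assumes "\<phi> \<in> KP \<mu>"
  shows "val_minimal \<mu> \<phi>"
  unfolding val_minimal_def
proof (intro allI impI)
  fix q a :: "'a poly"
  assume a: "degree a < degree \<phi>"
  show "\<mu> (q * \<phi> + a) = min (\<mu> (q * \<phi>)) (\<mu> a)"
  proof (cases "\<mu> (q * \<phi>) = \<mu> a \<and> \<mu> a \<noteq> Infty")
    case True
    then obtain \<alpha> where \<alpha>: "\<mu> a = Fin \<alpha>"
      by (auto simp: not_Infty_eq)
    obtain \<beta> where \<beta>: "\<mu> \<phi> = Fin \<beta>"
      using KP_value_finite[OF assms] by (auto simp: not_Infty_eq)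
    have "a \<noteq> 0"
      using \<alpha> val_0[OF val] by auto
    then have "\<not> graded_dvd \<mu> \<phi> a"
      using assms a by (auto simp: KP_def graded_minimal_def)
    then have "\<not> Fin \<alpha> < \<mu> (a - (- q) * \<phi>)"
      using graded_dvd_iff[OF val \<beta> \<alpha>] by blast
    then have "\<mu> (q * \<phi> + a) \<le> \<mu> a"
      using \<alpha> by (simp add: algebra_simps not_less)
    then show ?thesis
      using val_add[OF val, of "q * \<phi>" a] True by auto
  next
    case False
    then show ?thesis
      using val_add_eq_min[OF val, of "q * \<phi>" a] val_add[OF val, of "q * \<phi>" a] by fastforce
  qed
qed

text \<open>If the remainder had a larger value than \<open>a * b\<close>, the initial form of
  \<open>\<phi>\<close> would divide that of the product, hence that of a factor, against graded
  minimality.\<close>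

lemma KP_val_prime:
  assumes "\<phi> \<in> KP \<mu>"
  shows "val_prime \<mu> \<phi>"
  unfolding val_prime_def
proof (intro allI impI)
  fix a b :: "'a poly"
  assume a: "degree a < degree \<phi>" and b: "degree b < degree \<phi>"
  obtain \<gamma> where \<gamma>: "\<mu> \<phi> = Fin \<gamma>"
    using KP_value_finite[OF assms] by (auto simp: not_Infty_eq)
  have ab: "\<mu> (a * b) = min (\<mu> (a * b div \<phi> * \<phi>)) (\<mu> (a * b mod \<phi>))"
    using assms by (intro val_minimal_div_mod KP_val_minimal KP_degree_pos)
  then have le: "\<mu> (a * b) \<le> \<mu> (a * b mod \<phi>)"
    by simp
  show "\<mu> (a * b mod \<phi>) = \<mu> a + \<mu> b"
  proof (cases "\<mu> (a * b)")
    case Infty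
    then show ?thesis
      using le by (simp add: val_mult[OF val, symmetric])
  next
    case (Fin \<alpha>)
    then have fin: "\<mu> a \<noteq> Infty" "\<mu> b \<noteq> Infty"
      by (auto simp: val_mult[OF val])
    then have "a \<noteq> 0" "b \<noteq> 0"
      using val_0[OF val] by auto
    then have "\<not> graded_dvd \<mu> \<phi> a" "\<not> graded_dvd \<mu> \<phi> b"
      using assms a b by (auto simp: KP_def graded_minimal_def)
    then have "\<not> graded_dvd \<mu> \<phi> (a * b)"
      using assms graded_irreducible_dvd_mult[OF val _ fin] by (auto simp: KP_def)
    then have "\<not> Fin \<alpha> < \<mu> (a * b - a * b div \<phi> * \<phi>)"
      using graded_dvd_iff[OF val \<gamma> Fin] by blast
    then have "\<mu> (a * b mod \<phi>) \<le> \<mu> (a * b)"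
      using Fin by (simp add: minus_div_mult_eq_mod not_less)
    with le show ?thesis
      by (simp add: val_mult[OF val, symmetric])
  qed
qed

text \<open>By the weight bound, a monic polynomial of value \<open>Infty\<close> would force
  \<open>\<mu> \<phi> = Infty\<close>, but the initial form of a key polynomial is nonzero.\<close>

lemma KP_trivial_support:
  assumes "\<phi> \<in> KP \<mu>" and "f \<noteq> 0"
  shows "\<mu> f \<noteq> Infty"
proof
  define g where "g = smult (inverse (lead_coeff f)) f"
  assume "\<mu> f = Infty"
  then have "\<mu> g = Infty"
    using val_mult[OF val, of "[:inverse (lead_coeff f):]" f] by (simp add: g_def)
  moreover have "monic g"
    unfolding g_def using assms(2) by (rule monic_normalise)
  ultimately have "nsmul (degree g) (\<mu> \<phi>) = Infty"
    using val_minimal_weight[OF val KP_val_minimal[OF assms(1)] KP_monic[OF assms(1)]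
        KP_degree_pos[OF assms(1)], of g] KP_degree_pos[OF assms(1)]
    by (simp add: nsmul_Infty)
  moreover obtain \<beta> where "\<mu> \<phi> = Fin \<beta>"
    using KP_value_finite[OF assms(1)] by (auto simp: not_Infty_eq)
  ultimately show False
    by (simp add: nsmul_Fin)
qed

text \<open>For a proper factorization the remainder in \<open>val_prime\<close> is 0, so one factor
  would have value \<open>Infty\<close> although the support is zero.\<close>

lemma KP_irreducible:
  assumes "\<phi> \<in> KP \<mu>"
  shows "irreducible \<phi>"
proof (rule irreducibleI)
  show "\<phi> \<noteq> 0"
    using assms KP_monic monic_nonzero by blast
  then show "\<not> is_unit \<phi>"
    using KP_degree_pos[OF assms] by (simp add: is_unit_iff_degree)
  fix a b assume ab: "\<phi> = a * b"
  show "is_unit a \<or> is_unit b"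
  proof (rule ccontr)
    assume neg: "\<not> ?thesis"
    have nz: "a \<noteq> 0" "b \<noteq> 0"
      using ab \<open>\<phi> \<noteq> 0\<close> by auto
    then have "0 < degree a" "0 < degree b"
      using neg by (auto simp: is_unit_iff_degree)
    then have "degree a < degree \<phi>" "degree b < degree \<phi>"
      using nz by (auto simp: ab degree_mult_eq)
    from val_primeD[OF KP_val_prime[OF assms] this] ab have "\<mu> a + \<mu> b = Infty"
      by (simp add: val_0[OF val])
    then show False
      using KP_trivial_support[OF assms] nz by auto
  qed
qed

text \<open>The valuation \<open>f \<mapsto> \<mu> (f mod \<phi>)\<close> dominates \<open>\<mu>\<close>, and the kernel of the induced map of graded
  algebras is the ideal generated by the initial form of \<open>\<phi>\<close>.\<close>

lemma val_mod_valuation: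
  assumes "val_prime \<mu> \<phi>" and "0 < degree \<phi>"
  shows "is_valuation (\<lambda>f. \<mu> (f mod \<phi>))"
  unfolding is_valuation_def
proof (intro conjI allI)
  show "\<mu> (0 mod \<phi>) = Infty"
    by (simp add: val_0[OF val])
  show "\<mu> (1 mod \<phi>) = 0"
    using assms(2) by (simp add: mod_poly_less val_1[OF val])
  fix x y :: "'a poly"
  show "\<mu> (x * y mod \<phi>) = \<mu> (x mod \<phi>) + \<mu> (y mod \<phi>)"
    using val_primeD[OF assms(1) degree_mod_less_pos[OF assms(2), of x] degree_mod_less_pos[OF assms(2), of y]]
    by (simp add: mod_mult_eq)
  show "min (\<mu> (x mod \<phi>)) (\<mu> (y mod \<phi>)) \<le> \<mu> ((x + y) mod \<phi>)"
    using val_add[OF val] by (simp add: poly_mod_add_left)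
qed

text \<open>Reduction modulo \<open>\<phi>\<close> kills multiples of \<open>\<phi>\<close> and
  never lowers \<open>\<mu>\<close>, so the ideal lies in the kernel. Conversely each component is
  divided by \<open>\<phi>\<close>, and minimality keeps the quotients in the right filtration
  step.\<close>

lemma coset_in_PIdl_iff:
  assumes "val_minimal \<mu> \<phi>" and "0 < degree \<phi>" and "\<mu> \<phi> = Fin \<gamma>" and p: "filtered \<mu> p"
  shows "filtration_plus_sum \<mu> +>\<^bsub>filtration_sum \<mu>\<^esub> p \<in> PIdl\<^bsub>graded_algebra \<mu>\<^esub> (initial_form \<mu> \<phi>) \<longleftrightarrow>
    filtered_plus (\<lambda>f. \<mu> (f mod \<phi>)) p"
    (is "?coset p \<in> _ \<longleftrightarrow> _")
proof -
  have s: "filtered \<mu> (Poly_Mapping.single \<gamma> \<phi>)"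
    using assms(3) by (intro filtered_single[OF val]) simp
  have in_iff: "?coset p \<in> PIdl\<^bsub>graded_algebra \<mu>\<^esub> (initial_form \<mu> \<phi>) \<longleftrightarrow>
      (\<exists>Q. filtered \<mu> Q \<and> filtered_plus \<mu> (p - Poly_Mapping.single \<gamma> \<phi> * Q))"
    (is "_ \<longleftrightarrow> ?R")
  proof -
    have "?coset p \<in> PIdl\<^bsub>graded_algebra \<mu>\<^esub> (initial_form \<mu> \<phi>) \<longleftrightarrow>
       (\<exists>Q. filtered \<mu> Q \<and> ?coset p =
          ?coset Q \<otimes>\<^bsub>graded_algebra \<mu>\<^esub> ?coset (Poly_Mapping.single \<gamma> \<phi>))"
      unfolding cgenideal_def carrier_graded_algebra[OF val] initial_form_Fin[OF val assms(3)]
      by blast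
    also have "\<dots> \<longleftrightarrow> ?R"
      using p s
      by (intro ex_cong1 conj_cong refl)
        (simp add: coset_mult[OF val] coset_eq_iff[OF val] filtered_mult[OF val] mult.commute)
    finally show ?thesis .
  qed
  have mod_le: "\<mu> f \<le> \<mu> (f mod \<phi>)" for f
    using val_minimal_div_mod[OF assms(1,2), of f] by simp
  show ?thesis
  proof
    assume "?coset p \<in> PIdl\<^bsub>graded_algebra \<mu>\<^esub> (initial_form \<mu> \<phi>)"
    then obtain Q where Q: "filtered_plus \<mu> (p - Poly_Mapping.single \<gamma> \<phi> * Q)"
      using in_iff by blast
    show "filtered_plus (\<lambda>f. \<mu> (f mod \<phi>)) p"
      unfolding filtered_plus_def
    proof
      fix \<alpha>
      let ?d = "Poly_Mapping.lookup p \<alpha> - \<phi> * Poly_Mapping.lookup Q (\<alpha> - \<gamma>)"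
      have "Fin \<alpha> < \<mu> ?d"
        using Q unfolding filtered_plus_def
        by (metis lookup_minus lookup_single_mult)
      also have "\<dots> \<le> \<mu> (?d mod \<phi>)"
        by (rule mod_le)
      also have "?d mod \<phi> = Poly_Mapping.lookup p \<alpha> mod \<phi>"
        by (simp add: poly_mod_diff_left)
      finally show "Fin \<alpha> < \<mu> (Poly_Mapping.lookup p \<alpha> mod \<phi>)" .
    qed
  next
    assume hp: "filtered_plus (\<lambda>f. \<mu> (f mod \<phi>)) p"
    \<comment> \<open>Multiplication by \<open>single \<gamma> \<phi>\<close> raises the index by
      \<open>\<gamma>\<close>. With this shift the component of the difference at
      \<open>\<alpha>\<close> is exactly the remainder of that of \<open>p\<close>.\<close>
    let ?q = "\<lambda>\<beta>. Poly_Mapping.lookup p (\<beta> + \<gamma>) div \<phi>"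
    define Q where "Q = Poly_Mapping.Abs_poly_mapping ?q"
    have "{\<beta>. ?q \<beta> \<noteq> 0} \<subseteq> (\<lambda>\<alpha>. \<alpha> - \<gamma>) ` Poly_Mapping.keys p"
    proof
      fix \<beta> assume "\<beta> \<in> {\<beta>. ?q \<beta> \<noteq> 0}"
      then have "\<beta> + \<gamma> \<in> Poly_Mapping.keys p"
        by (auto simp: in_keys_iff)
      then show "\<beta> \<in> (\<lambda>\<alpha>. \<alpha> - \<gamma>) ` Poly_Mapping.keys p"
        by (intro image_eqI[of _ _ "\<beta> + \<gamma>"]) auto
    qed
    then have "finite {\<beta>. ?q \<beta> \<noteq> 0}"
      by (rule finite_subset) simp
    then have lQ: "Poly_Mapping.lookup Q = ?q"
      unfolding Q_def by simp
    have "filtered \<mu> Q"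
      unfolding filtered_def lQ
    proof
      fix \<beta>
      have "Fin (\<beta> + \<gamma>) \<le> \<mu> (Poly_Mapping.lookup p (\<beta> + \<gamma>))"
        using p by (simp add: filtered_def)
      also have "\<dots> \<le> \<mu> (?q \<beta> * \<phi>)"
        by (subst val_minimal_div_mod[OF assms(1,2)]) simp
      finally show "Fin \<beta> \<le> \<mu> (?q \<beta>)"
        by (cases "\<mu> (?q \<beta>)") (auto simp: val_mult[OF val] assms(3))
    qed
    moreover have "filtered_plus \<mu> (p - Poly_Mapping.single \<gamma> \<phi> * Q)"
      using hp unfolding filtered_plus_def lookup_minus lookup_single_mult lQ
      by (simp add: minus_mult_div_eq_mod)
    ultimately show "?coset p \<in> PIdl\<^bsub>graded_algebra \<mu>\<^esub> (initial_form \<mu> \<phi>)"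
      using in_iff by blast
  qed
qed

text \<open>The ideal is the kernel of a map into the graded algebra of
  \<open>f \<mapsto> \<mu> (f mod \<phi>)\<close>, and \<open>filtered_plus_prime\<close> says that
  the latter is a domain. Hence the ideal is prime.\<close>

lemma KP_I:
  assumes "monic \<phi>" and deg: "0 < degree \<phi>" and min: "val_minimal \<mu> \<phi>" and prime: "val_prime \<mu> \<phi>"
    and supp: "\<And>f. f \<noteq> 0 \<Longrightarrow> \<mu> f \<noteq> Infty"
  shows "\<phi> \<in> KP \<mu>"
proof -
  interpret G: cring "graded_algebra \<mu>"
    by (rule cring_graded_algebra[OF val])
  let ?coset = "\<lambda>p. filtration_plus_sum \<mu> +>\<^bsub>filtration_sum \<mu>\<^esub> p"
  let ?I = "PIdl\<^bsub>graded_algebra \<mu>\<^esub> (initial_form \<mu> \<phi>)" and ?w = "\<lambda>f. \<mu> (f mod \<phi>)"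
  obtain \<gamma> where \<gamma>: "\<mu> \<phi> = Fin \<gamma>"
    using supp[OF monic_nonzero[OF assms(1)]] by (auto simp: not_Infty_eq)
  note in_iff = coset_in_PIdl_iff[OF min deg \<gamma>]
  have w: "is_valuation ?w"
    by (rule val_mod_valuation[OF prime deg])
  have w_hom: "filtered ?w p" if "filtered \<mu> p" for p
    unfolding filtered_def
  proof
    fix \<alpha>
    show "Fin \<alpha> \<le> ?w (Poly_Mapping.lookup p \<alpha>)"
      using that val_minimal_div_mod[OF min deg, of "Poly_Mapping.lookup p \<alpha>"]
      by (metis filtered_def min.boundedE)
  qed
  have "primeideal ?I (graded_algebra \<mu>)"
  proof (rule primeidealI)
    show "ideal ?I (graded_algebra \<mu>)"
      by (rule G.cgenideal_ideal[OF initial_form_carrier[OF val]])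
    show "cring (graded_algebra \<mu>)"
      by (rule cring_graded_algebra[OF val])
    have h1: "filtered \<mu> (Poly_Mapping.single 0 1)"
      by (intro filtered_single[OF val]) (simp add: val_1[OF val] zero_with_top_def)
    have "\<not> filtered_plus ?w (Poly_Mapping.single 0 1)"
      unfolding filtered_plus_def
      using val_1[OF w] by (metis less_irrefl lookup_single_eq zero_with_top_def)
    then have "?coset (Poly_Mapping.single 0 1) \<notin> ?I"
      using in_iff[OF h1] by simp
    moreover have "?coset (Poly_Mapping.single 0 1) \<in> carrier (graded_algebra \<mu>)"
      using h1 by (auto simp: carrier_graded_algebra[OF val])
    ultimately show "carrier (graded_algebra \<mu>) \<noteq> ?I"
      by blast
  next
    fix A B
    assume "A \<in> carrier (graded_algebra \<mu>)" "B \<in> carrier (graded_algebra \<mu>)"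
      and AB: "A \<otimes>\<^bsub>graded_algebra \<mu>\<^esub> B \<in> ?I"
    then obtain p q where p: "filtered \<mu> p" "A = ?coset p"
      and q: "filtered \<mu> q" "B = ?coset q"
      by (auto simp: carrier_graded_algebra[OF val])
    have "filtered_plus ?w (p * q)"
      using AB in_iff[OF filtered_mult[OF val p(1) q(1)]]
      by (simp add: p q coset_mult[OF val])
    then have "filtered_plus ?w p \<or> filtered_plus ?w q"
      using p q by (intro filtered_plus_prime[OF w] w_hom)
    then show "A \<in> ?I \<or> B \<in> ?I"
      using in_iff p q by simp
  qed
  then have "graded_irreducible \<mu> \<phi>"
    unfolding graded_irreducible_def using initial_form_Fin_nonzero[OF val \<gamma>] by simp
  moreover have "graded_minimal \<mu> \<phi>"
    unfolding graded_minimal_def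
  proof (intro allI impI notI)
    fix f assume f: "f \<noteq> 0 \<and> degree f < degree \<phi>" and dvd: "graded_dvd \<mu> \<phi> f"
    obtain \<alpha> where \<alpha>: "\<mu> f = Fin \<alpha>"
      using supp f by (auto simp: not_Infty_eq)
    obtain q where "Fin \<alpha> < \<mu> (f - q * \<phi>)"
      using dvd graded_dvd_iff[OF val \<gamma> \<alpha>] by blast
    then show False
      using val_minimalD[OF min, of f "- q"] f \<alpha> by simp
  qed
  ultimately show ?thesis
    using assms(1) by (simp add: KP_def)
qed

end

section \<open>Augmentations\<close>

lemma expansion_induct [consumes 1, case_names zero step]:
  fixes \<phi> :: "'a::field poly"
  assumes "0 < degree \<phi>" and "P 0"
    and step: "\<And>q a. degree a < degree \<phi> \<Longrightarrow> P q \<Longrightarrow> P (q * \<phi> + a)"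
  shows "P f"
proof (induction "degree f" arbitrary: f rule: less_induct)
  case less
  have "P (f div \<phi>)"
  proof (cases "f div \<phi> = 0")
    case False
    then have q: "degree (f div \<phi> * \<phi>) = degree (f div \<phi>) + degree \<phi>"
      using assms(1) by (intro degree_mult_eq) auto
    then have "degree (f mod \<phi>) < degree (f div \<phi> * \<phi>)"
      using degree_mod_less_pos[OF assms(1), of f] by simp
    then have "degree f = degree (f div \<phi>) + degree \<phi>"
      using degree_add_eq_left[of "f mod \<phi>" "f div \<phi> * \<phi>"] q by simp
    then show ?thesis
      using assms(1) by (intro less) linarith
  qed (use assms in simp)
  from step[OF degree_mod_less_pos[OF assms(1)] this, of f] show ?case
    by simp
qed

lemma expansion_coeff_rec:
  fixes \<phi> q a :: "'a::field poly"
  assumes "degree a < degree \<phi>"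
  shows "expansion_coeff \<phi> (q * \<phi> + a) 0 = a"
    and "expansion_coeff \<phi> (q * \<phi> + a) (Suc s) = expansion_coeff \<phi> q s"
proof -
  have "\<phi> \<noteq> 0"
    using assms by auto
  then have "(q * \<phi> + a) div \<phi> = q"
    using assms by (simp add: div_poly_less poly_div_add_left)
  then show "expansion_coeff \<phi> (q * \<phi> + a) (Suc s) = expansion_coeff \<phi> q s"
    by (simp add: expansion_coeff_def poly_div_mult_right)
  show "expansion_coeff \<phi> (q * \<phi> + a) 0 = a"
    using assms by (simp add: expansion_coeff_def mod_poly_less poly_mod_add_left)
qed

section \<open>Augmentation of a function that need not be a valuation, such as
  \<open>limit_val\<close>\<close>

context
  fixes \<mu> :: "'a::field poly \<Rightarrow> 'g::linordered_ab_group_add with_top" and \<phi> :: "'a poly"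
  assumes \<mu>0: "\<mu> 0 = Infty" and deg: "0 < degree \<phi>"
begin

text \<open>Coefficients beyond the degree vanish and contribute \<open>Infty\<close>. The freedom
  in \<open>N\<close> lets polynomials of different degrees be compared over a common index
  range.\<close>

lemma augmentation_eq_Min:
  assumes "degree f \<le> N"
  shows "augmentation \<mu> \<phi> \<gamma> f = Min ((\<lambda>s. \<mu> (expansion_coeff \<phi> f s) + nsmul s \<gamma>) ` {..N})"
    (is "_ = Min (?t ` _)")
  unfolding augmentation_def
proof (rule antisym)
  show "Min (?t ` {..N}) \<le> Min (?t ` {..degree f})"
    using assms by (intro Min_antimono image_mono) auto
  have "Min (?t ` {..degree f}) \<le> ?t s" for s
  proof (cases "s \<le> degree f")
    case False
    have "\<phi> \<noteq> 0"
      using deg by auto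
    moreover have "degree f < s * degree \<phi>"
      using False mult_le_mono2[of 1 "degree \<phi>" s] deg by linarith
    ultimately have "f div \<phi> ^ s = 0"
      by (intro div_poly_less) (simp add: degree_power_eq)
    then show ?thesis
      by (simp add: expansion_coeff_def \<mu>0)
  next
    case True
    then show ?thesis
      by (intro Min.coboundedI finite_imageI imageI) auto
  qed
  then show "Min (?t ` {..degree f}) \<le> Min (?t ` {..N})"
    by (intro Min.boundedI) auto
qed

text \<open>One Horner step: the coefficients of \<open>q\<close> move up by one index, at the cost
  of one \<open>\<gamma>\<close>. Together with \<open>expansion_induct\<close> it replaces the
  explicit minimum in later arguments.\<close>

lemma augmentation_rec:
  assumes "degree a < degree \<phi>"
  shows "augmentation \<mu> \<phi> \<gamma> (q * \<phi> + a) = min (\<mu> a) (augmentation \<mu> \<phi> \<gamma> q + \<gamma>)"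
proof -
  let ?t = "\<lambda>f s. \<mu> (expansion_coeff \<phi> f s) + nsmul s \<gamma>" and ?f = "q * \<phi> + a"
  define N where "N = max (degree ?f) (degree q)"
  have t0: "?t ?f 0 = \<mu> a" and tS: "?t ?f (Suc s) = ?t q s + \<gamma>" for s
    by (simp_all only: expansion_coeff_rec[OF assms] nsmul.simps add_0_right) (simp add: ac_simps)
  have "augmentation \<mu> \<phi> \<gamma> ?f = Min (?t ?f ` {..Suc N})"
    by (rule augmentation_eq_Min) (simp add: N_def)
  also have "?t ?f ` {..Suc N} = insert (?t ?f 0) ((\<lambda>s. ?t ?f (Suc s)) ` {..N})"
    by (simp only: atMost_Suc_eq_insert_0 image_insert image_image)
  also have "\<dots> = insert (\<mu> a) ((\<lambda>x. x + \<gamma>) ` ?t q ` {..N})"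
    by (simp only: t0 tS image_image)
  also have "Min \<dots> = min (\<mu> a) (Min ((\<lambda>x. x + \<gamma>) ` ?t q ` {..N}))"
    by (intro Min_insert) auto
  also have "Min ((\<lambda>x. x + \<gamma>) ` ?t q ` {..N}) = Min (?t q ` {..N}) + \<gamma>"
    by (intro mono_Min_commute[symmetric]) (auto intro: monoI add_right_mono)
  also have "Min (?t q ` {..N}) = augmentation \<mu> \<phi> \<gamma> q"
    by (rule augmentation_eq_Min[symmetric]) (simp add: N_def)
  finally show ?thesis .
qed

lemma augmentation_0: "augmentation \<mu> \<phi> \<gamma> 0 = Infty"
  by (simp add: augmentation_def expansion_coeff_def \<mu>0)

lemma augmentation_low: "degree a < degree \<phi> \<Longrightarrow> augmentation \<mu> \<phi> \<gamma> a = \<mu> a"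
  using augmentation_rec[of a \<gamma> 0] by (simp add: augmentation_0 min_def)

lemma augmentation_self:
  assumes "\<mu> 1 = 0"
  shows "augmentation \<mu> \<phi> \<gamma> \<phi> = \<gamma>"
  using augmentation_rec[of 0 \<gamma> 1] augmentation_low[of 1] deg assms by (simp add: \<mu>0 min_def)

lemma augmentation_val_minimal:
  assumes "\<mu> 1 = 0" and "is_valuation (augmentation \<mu> \<phi> \<gamma>)"
  shows "val_minimal (augmentation \<mu> \<phi> \<gamma>) \<phi>"
  unfolding val_minimal_def
  by (simp add: augmentation_rec val_mult[OF assms(2)] augmentation_self[OF assms(1)]
      augmentation_low min.commute)

text \<open>A valuation is at least the minimum over the terms of any expansion, and each term is
  dominated. In \<open>chi_strict_mono\<close>, \<open>\<nu>\<close> is itself another augmentation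
  of \<open>\<mu>\<close>.\<close>

lemma augmentation_le:
  assumes \<nu>: "is_valuation \<nu>" and "\<gamma> \<le> \<nu> \<phi>" and low: "\<And>a. degree a < degree \<phi> \<Longrightarrow> \<mu> a \<le> \<nu> a"
  shows "augmentation \<mu> \<phi> \<gamma> f \<le> \<nu> f"
  using deg
proof (induction f rule: expansion_induct)
  case zero
  show ?case by (simp add: val_0[OF \<nu>])
next
  case (step q a)
  have "augmentation \<mu> \<phi> \<gamma> q + \<gamma> \<le> \<nu> (q * \<phi>)"
    using step assms(2) by (auto simp: val_mult[OF \<nu>] intro: add_mono)
  then show ?case
    using step low[of a] unfolding augmentation_rec[OF step(1)]
    by (intro val_add_le[OF \<nu>]) (auto simp: min_le_iff_disj)
qed

end

text \<open>By minimality \<open>\<mu>\<close> is already the minimum over the terms of the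
  expansion; replacing \<open>\<mu> \<phi>\<close> by \<open>\<gamma>\<close> only raises these
  terms.\<close>

lemma le_augmentation:
  assumes \<mu>: "is_valuation \<mu>" and min: "val_minimal \<mu> \<phi>" and deg: "0 < degree \<phi>" and "\<mu> \<phi> \<le> \<gamma>"
  shows "\<mu> f \<le> augmentation \<mu> \<phi> \<gamma> f"
  using deg
proof (induction f rule: expansion_induct)
  case zero
  show ?case by (simp add: augmentation_0[of \<mu> \<phi>] val_0[OF \<mu>] deg)
next
  case (step q a)
  have "\<mu> (q * \<phi>) \<le> augmentation \<mu> \<phi> \<gamma> q + \<gamma>"
    using step assms(4) by (auto simp: val_mult[OF \<mu>] intro: add_mono)
  then show ?case
    unfolding augmentation_rec[of \<mu> \<phi>, OF val_0[OF \<mu>] deg step(1)] val_minimalD[OF min step(1)]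
    by (simp add: min_le_iff_disj)
qed

text \<open>\<open>\<rho>\<close> stands for the valuation below \<open>\<mu>'\<close> in an ordinary augmentation, and for a valuation far
  enough in the family in a limit augmentation.\<close>

lemma degree_le_of_val_minimal:
  assumes \<mu>': "is_valuation \<mu>'" and "monic \<phi>"
    and low: "\<And>a b c. degree a < degree \<phi> \<Longrightarrow> degree b < degree \<phi> \<Longrightarrow> degree c < degree \<phi> \<Longrightarrow>
      \<exists>\<rho>. is_valuation \<rho> \<and> \<rho> a = \<mu>' a \<and> \<rho> b = \<mu>' b \<and> \<rho> c = \<mu>' c \<and> \<rho> \<phi> < \<mu>' \<phi>"
    and "monic \<psi>" and "0 < degree \<psi>" and min: "val_minimal \<mu>' \<psi>"
  shows "degree \<phi> \<le> degree \<psi>"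
proof (rule ccontr)
  let ?q = "\<phi> div \<psi>" and ?b = "\<phi> mod \<psi>"
  assume "\<not> ?thesis"
  then have lt: "degree \<psi> < degree \<phi>"
    by simp
  have "degree ?q < degree \<phi>"
    using monic_div(2)[OF \<open>monic \<phi>\<close> \<open>monic \<psi>\<close>] lt assms(5) by linarith
  moreover have "degree ?b < degree \<phi>"
    using degree_mod_less_pos[OF assms(5), of \<phi>] lt by simp
  ultimately obtain \<rho> where \<rho>: "is_valuation \<rho>" "\<rho> ?q = \<mu>' ?q" "\<rho> \<psi> = \<mu>' \<psi>" "\<rho> ?b = \<mu>' ?b" "\<rho> \<phi> < \<mu>' \<phi>"
    using low lt by blast
  \<comment> \<open>The quotient, \<open>\<psi>\<close> and the remainder all lie below
    \<open>degree \<phi>\<close>, so \<open>\<rho>\<close> gives both terms their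
    \<open>\<mu>'\<close>-values. Minimality of \<open>\<psi>\<close> for \<open>\<mu>'\<close> then
    yields \<open>\<mu>' \<phi> \<le> \<rho> \<phi>\<close>.\<close>
  have "\<mu>' \<phi> = min (\<rho> (?q * \<psi>)) (\<rho> ?b)"
    using val_minimal_div_mod[OF min assms(5), of \<phi>] by (simp add: val_mult[OF \<mu>'] val_mult[OF \<rho>(1)] \<rho>)
  also have "\<dots> \<le> \<rho> (?q * \<psi> + ?b)"
    by (rule val_add[OF \<rho>(1)])
  finally show False
    using \<rho>(5) by simp
qed

lemma val_deg_eq:
  assumes "\<phi> \<in> KP \<mu>" and "\<And>\<psi>. \<psi> \<in> KP \<mu> \<Longrightarrow> degree \<phi> \<le> degree \<psi>"
  shows "val_deg \<mu> = degree \<phi>"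
  unfolding val_deg_def using assms by (auto intro!: Least_equality)

lemma val_prime_cong:
  assumes "val_prime \<mu> \<phi>" and "0 < degree \<phi>" and "\<And>a. degree a < degree \<phi> \<Longrightarrow> \<mu>' a = \<mu> a"
  shows "val_prime \<mu>' \<phi>"
  using assms degree_mod_less_pos[OF assms(2)] by (simp add: val_prime_def)

section \<open>Limit augmentations\<close>

context
  fixes v :: "'a::field \<Rightarrow> 'g::linordered_ab_group_add with_top"
    and I :: "'i::linorder set" and \<rho> :: "'i \<Rightarrow> 'a poly \<Rightarrow> 'g with_top"
  assumes fam: "val_family v I \<rho>"
begin

lemma family_valuation: "i \<in> I \<Longrightarrow> is_valuation (\<rho> i)"
  and family_const: "i \<in> I \<Longrightarrow> \<rho> i [:c:] = v c"
  using fam by (auto simp: val_family_def poly_valuation_def)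

lemma family_less: "i \<in> I \<Longrightarrow> j \<in> I \<Longrightarrow> i < j \<Longrightarrow> \<rho> i < \<rho> j"
  using fam by (auto simp: val_family_def strict_mono_on_def)

lemma family_mono: "i \<in> I \<Longrightarrow> j \<in> I \<Longrightarrow> i \<le> j \<Longrightarrow> \<rho> i f \<le> \<rho> j f"
  using family_less[of i j] by (cases "i = j") (auto simp: less_le le_fun_def)

lemma family_next: "i \<in> I \<Longrightarrow> \<exists>j\<in>I. i < j"
  using fam by (auto simp: val_family_def)

lemma family_nonempty: "I \<noteq> {}"
  using fam by (auto simp: val_family_def)

text \<open>The stable value is unique because the family has no last element: some index lies
  beyond any two witnesses.\<close>

lemma limit_val_eq:
  assumes "stable_value I \<rho> f x"
  shows "limit_val I \<rho> f = x"
  unfolding limit_val_def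
proof (rule the_equality)
  show "stable_value I \<rho> f x"
    by (rule assms)
  fix y assume "stable_value I \<rho> f y"
  then obtain i j where ij: "i \<in> I" "\<And>k. k \<in> I \<Longrightarrow> i < k \<Longrightarrow> \<rho> k f = x"
    "j \<in> I" "\<And>k. k \<in> I \<Longrightarrow> j < k \<Longrightarrow> \<rho> k f = y"
    using assms unfolding stable_value_def by blast
  have "max i j \<in> I"
    using ij by (auto simp: max_def)
  then obtain k where "k \<in> I" "max i j < k"
    using family_next by blast
  then show "y = x"
    using ij by (metis max_less_iff_conj)
qed

lemma stableD:
  assumes "stable I \<rho> f"
  shows "\<exists>i\<in>I. \<forall>j\<in>I. i \<le> j \<longrightarrow> \<rho> j f = limit_val I \<rho> f"
  using assms limit_val_eq unfolding stable_def stable_value_def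
  by (metis (no_types, lifting) order_le_less)

lemma stableI: "i \<in> I \<Longrightarrow> (\<And>j. j \<in> I \<Longrightarrow> i \<le> j \<Longrightarrow> \<rho> j f = c) \<Longrightarrow> stable I \<rho> f"
  unfolding stable_def stable_value_def by (metis order_le_less)

lemma stable_const: "stable I \<rho> [:c:]"
  using family_const family_nonempty by (auto intro: stableI)

text \<open>The values of both factors are nondecreasing along the family, so a constant finite sum
  forces each of them to be constant. Finiteness matters because \<open>Infty\<close> would absorb
  an increase.\<close>

lemma unstable_mult:
  assumes "\<not> stable I \<rho> \<phi>" and i: "i \<in> I" and const: "\<And>j. j \<in> I \<Longrightarrow> i \<le> j \<Longrightarrow> \<rho> j (q * \<phi>) = c"
    and "c \<noteq> Infty"
  shows False
proof -
  have "\<rho> j \<phi> = \<rho> i \<phi>" if j: "j \<in> I" "i \<le> j" for j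
  proof (rule ccontr)
    assume "\<rho> j \<phi> \<noteq> \<rho> i \<phi>"
    then have lt: "\<rho> i \<phi> < \<rho> j \<phi>"
      using family_mono[OF i j, of \<phi>] by simp
    have "\<rho> i q + \<rho> i \<phi> = c" "\<rho> j q + \<rho> j \<phi> = c"
      using const[OF i] const[OF j] by (simp_all add: val_mult family_valuation i j)
    then show False
      using lt family_mono[OF i j, of q] \<open>c \<noteq> Infty\<close>
        with_top_add_less_le_mono[OF lt family_mono[OF i j, of q]]
      by (metis add.commute add_eq_Infty_iff less_irrefl)
  qed
  then have "stable I \<rho> \<phi>"
    by (intro stableI[OF i])
  with assms(1) show False ..
qed

context
  fixes \<phi> :: "'a poly"
  assumes phi: "\<phi> \<in> KP_inf I \<rho>"
begin

lemma KP_inf_monic: "monic \<phi>"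
  and KP_inf_unstable: "\<not> stable I \<rho> \<phi>"
  using phi by (auto simp: KP_inf_def)

lemma KP_inf_stable:
  assumes "degree f < degree \<phi>"
  shows "stable I \<rho> f"
proof (cases "f = 0")
  case True
  then show ?thesis
    using stable_const[of 0] by simp
next
  case False
  define g where "g = smult (inverse (lead_coeff f)) f"
  have "degree g < degree \<phi>"
    using assms False by (simp add: g_def)
  moreover have "monic g"
    unfolding g_def using False by (rule monic_normalise)
  ultimately have "stable I \<rho> g"
    using phi by (auto simp: KP_inf_def not_le[symmetric])
  then obtain i where i: "i \<in> I" "\<And>j. j \<in> I \<Longrightarrow> i \<le> j \<Longrightarrow> \<rho> j g = limit_val I \<rho> g"
    using stableD by blast
  have f: "f = [:lead_coeff f:] * g"
    using False by (simp add: g_def)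
  have "\<rho> j f = v (lead_coeff f) + limit_val I \<rho> g" if "j \<in> I" "i \<le> j" for j
    using i that by (subst f) (simp only: val_mult[OF family_valuation] family_const)
  with i(1) show ?thesis
    by (rule stableI)
qed

lemma KP_inf_degree_pos: "0 < degree \<phi>"
  using KP_inf_unstable stable_const by (metis degree_eq_zeroE neq0_conv)

lemma deg_inf_eq: "deg_inf I \<rho> = enat (degree \<phi>)"
proof -
  have "(\<lambda>\<psi>. enat (degree \<psi>)) ` KP_inf I \<rho> = {enat (degree \<phi>)}"
    using phi by (force simp: KP_inf_def intro: antisym)
  then show ?thesis
    by (simp add: deg_inf_def)
qed

context
  fixes \<gamma> :: "'g with_top"
  assumes \<gamma>: "\<And>i. i \<in> I \<Longrightarrow> \<rho> i \<phi> < \<gamma>"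
    and val: "is_valuation (augmentation (limit_val I \<rho>) \<phi> \<gamma>)"
begin

private abbreviation (input) "\<mu>' \<equiv> augmentation (limit_val I \<rho>) \<phi> \<gamma>"

lemma limit_val_0: "limit_val I \<rho> 0 = Infty"
  using limit_val_eq[of 0 Infty] family_nonempty val_0[OF family_valuation]
  unfolding stable_value_def by (metis equals0I)

lemma limit_val_1: "limit_val I \<rho> 1 = 0"
  using limit_val_eq[of 1 0] family_nonempty val_1[OF family_valuation]
  unfolding stable_value_def by (metis equals0I)

lemma limit_augmentation_low: "degree a < degree \<phi> \<Longrightarrow> \<mu>' a = limit_val I \<rho> a"
  by (rule augmentation_low[of "limit_val I \<rho>", OF limit_val_0 KP_inf_degree_pos])

lemma limit_augmentation_self: "\<mu>' \<phi> = \<gamma>"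
  by (rule augmentation_self[of "limit_val I \<rho>", OF limit_val_0 KP_inf_degree_pos limit_val_1])

lemma limit_augmentation_val_minimal: "val_minimal \<mu>' \<phi>"
  by (rule augmentation_val_minimal[of "limit_val I \<rho>", OF limit_val_0 KP_inf_degree_pos limit_val_1 val])

text \<open>Moves a computation with finitely many polynomials of low degree from the limit
  augmentation to single members of the family, where \<open>\<phi>\<close> has a value smaller than
  \<open>\<gamma>\<close>.\<close>

lemma limit_augmentation_eventually:
  assumes "finite S" and "\<And>f. f \<in> S \<Longrightarrow> degree f < degree \<phi>"
  shows "\<exists>i\<in>I. \<forall>j\<in>I. i \<le> j \<longrightarrow> (\<forall>f\<in>S. \<rho> j f = \<mu>' f)"
  using assms
proof (induction S rule: finite_induct)
  case empty
  then show ?case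
    using family_nonempty by auto
next
  case (insert f S)
  obtain i where i: "i \<in> I" "\<And>j. j \<in> I \<Longrightarrow> i \<le> j \<Longrightarrow> \<forall>f\<in>S. \<rho> j f = \<mu>' f"
    using insert by auto
  obtain k where k: "k \<in> I" "\<And>j. j \<in> I \<Longrightarrow> k \<le> j \<Longrightarrow> \<rho> j f = \<mu>' f"
    using stableD[OF KP_inf_stable, of f] insert.prems limit_augmentation_low[of f] by auto
  have "max i k \<in> I"
    using i k by (auto simp: max_def)
  then show ?case
    using i k by (intro bexI[of _ "max i k"]) auto
qed

lemma limit_augmentation_witness:
  assumes "degree a < degree \<phi>" and "degree b < degree \<phi>" and "degree c < degree \<phi>"
  shows "\<exists>\<rho>. is_valuation \<rho> \<and> \<rho> a = \<mu>' a \<and> \<rho> b = \<mu>' b \<and> \<rho> c = \<mu>' c \<and> \<rho> \<phi> < \<mu>' \<phi>"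
proof -
  obtain i where "i \<in> I" "\<forall>f\<in>{a, b, c}. \<rho> i f = \<mu>' f"
    using limit_augmentation_eventually[of "{a, b, c}"] assms by auto
  then show ?thesis
    using \<gamma> family_valuation by (intro exI[of _ "\<rho> i"]) (auto simp: limit_augmentation_self)
qed

text \<open>If the stable values of \<open>a * b\<close> and of the remainder differed, their
  difference, a multiple of \<open>\<phi>\<close>, would have the smaller one as a constant value,
  against the instability of \<open>\<phi>\<close>.\<close>

lemma limit_augmentation_val_prime: "val_prime \<mu>' \<phi>"
  unfolding val_prime_def
proof (intro allI impI)
  fix a b :: "'a poly"
  assume ab: "degree a < degree \<phi>" "degree b < degree \<phi>"
  let ?d = "a * b mod \<phi>" and ?c = "a * b div \<phi>"
  have d: "degree ?d < degree \<phi>"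
    by (rule degree_mod_less_pos[OF KP_inf_degree_pos])
  then obtain i where i: "i \<in> I" "\<And>j. j \<in> I \<Longrightarrow> i \<le> j \<Longrightarrow> \<forall>f\<in>{a, b, ?d}. \<rho> j f = \<mu>' f"
    using limit_augmentation_eventually[of "{a, b, ?d}"] ab by auto
  show "\<mu>' ?d = \<mu>' a + \<mu>' b"
  proof (rule ccontr)
    assume neq: "\<mu>' ?d \<noteq> \<mu>' a + \<mu>' b"
    have "\<rho> j (?c * \<phi>) = min (\<mu>' a + \<mu>' b) (\<mu>' ?d)" if j: "j \<in> I" "i \<le> j" for j
    proof -
      note w = family_valuation[OF j(1)]
      have eq: "\<rho> j (a * b) = \<mu>' a + \<mu>' b" "\<rho> j ?d = \<mu>' ?d"
        using i(2)[OF j] by (auto simp: val_mult[OF w])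
      have "\<rho> j (?c * \<phi>) = \<rho> j (a * b - ?d)"
        by (simp add: minus_mod_eq_div_mult)
      also have "\<dots> = min (\<mu>' a + \<mu>' b) (\<mu>' ?d)"
        using neq eq by (subst val_diff_eq_min[OF w]) auto
      finally show ?thesis .
    qed
    moreover have "min (\<mu>' a + \<mu>' b) (\<mu>' ?d) \<noteq> Infty"
      using neq by (auto simp: min_def)
    ultimately show False
      using unstable_mult[OF KP_inf_unstable i(1)] by blast
  qed
qed

text \<open>The expansion bounds \<open>\<rho> i f\<close> only from below; an upper bound has to
  exclude cancellation between \<open>q * \<phi>\<close> and \<open>a\<close>. The induction is over
  all \<open>i\<close> at once because its hypothesis is needed at a later index.\<close>

lemma family_le_limit_augmentation: "i \<in> I \<Longrightarrow> \<rho> i f \<le> \<mu>' f"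
  using KP_inf_degree_pos
proof (induction f arbitrary: i rule: expansion_induct)
  case zero
  show ?case by (simp add: val_0[OF val])
next
  case (step q a)
  let ?f = "q * \<phi> + a"
  have f: "\<mu>' ?f = min (\<mu>' a) (\<mu>' q + \<gamma>)"
    using limit_augmentation_low[OF step(1)]
    by (subst augmentation_rec[of "limit_val I \<rho>", OF limit_val_0 KP_inf_degree_pos step(1)]) simp
  show ?case
  proof (rule ccontr)
    assume "\<not> ?case"
    then have lt: "\<mu>' ?f < \<rho> i ?f" by simp
    obtain k where k: "k \<in> I" "\<And>j. j \<in> I \<Longrightarrow> k \<le> j \<Longrightarrow> \<rho> j a = \<mu>' a"
      using limit_augmentation_eventually[of "{a}"] step(1) by auto
    define l where "l = max i k"
    have l: "l \<in> I"
      using step.prems k by (auto simp: l_def max_def)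
    show False
    \<comment> \<open>In the first case cancellation would persist at every index from
      \<open>l\<close> on and fix the value of \<open>q * \<phi>\<close> at \<open>\<mu>' a\<close>,
      against instability. In the second case \<open>a\<close> already has its larger stable value
      at \<open>l\<close>, too large to cancel \<open>q * \<phi>\<close>.\<close>
    proof (cases "\<mu>' a \<le> \<mu>' q + \<gamma>")
      case True
      then have lta: "\<mu>' a < \<rho> i ?f"
        using lt f by (simp add: min_def)
      have "\<rho> j (q * \<phi>) = \<mu>' a" if j: "j \<in> I" "l \<le> j" for j
      proof -
        note w = family_valuation[OF j(1)]
        have "\<rho> i ?f \<le> \<rho> j ?f"
          using step.prems j by (intro family_mono) (auto simp: l_def)
        then have "\<rho> j a < \<rho> j ?f" "\<rho> j a = \<mu>' a"
          using lta k(2)[of j] j by (auto simp: l_def)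
        then show ?thesis
          using val_diff_eq_min[OF w, of ?f a] by (auto simp: min_def not_le)
      qed
      moreover have "\<mu>' a \<noteq> Infty"
        using lta by auto
      ultimately show False
        using unstable_mult[OF KP_inf_unstable l] by blast
    next
      case False
      note w = family_valuation[OF l]
      have "\<rho> l (q * \<phi>) \<le> \<mu>' q + \<gamma>"
        using step.IH[OF l] \<gamma>[OF l] by (auto simp: val_mult[OF w] intro: add_mono)
      moreover have "\<rho> i ?f \<le> \<rho> l ?f"
        using step.prems l by (intro family_mono) (auto simp: l_def)
      ultimately have "\<rho> l (q * \<phi>) < \<rho> l ?f"
        using lt f False by (auto simp: min_def)
      then have "\<rho> l a = \<rho> l (q * \<phi>)"
        using val_diff_eq_min[OF w, of ?f "q * \<phi>"] by (auto simp: min_def not_le)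
      moreover have "\<rho> l a = \<mu>' a"
        using k(2) l by (simp add: l_def)
      ultimately show False
        using False \<open>\<rho> l (q * \<phi>) \<le> \<mu>' q + \<gamma>\<close> by simp
    qed
  qed
qed

end

end

end

section \<open>MLV chains\<close>

context
  fixes \<mu> \<mu>' :: "'a::field poly \<Rightarrow> 'g::linordered_ab_group_add with_top"
    and v :: "'a \<Rightarrow> 'g with_top" and k :: "('i::linorder, 'a poly \<Rightarrow> 'g with_top) step_kind"
    and \<psi> \<phi> :: "'a poly" and \<gamma> :: "'g with_top"
  assumes \<mu>: "is_valuation \<mu>" and \<mu>': "is_valuation \<mu>'" and step: "mlv_step v \<mu> \<psi> k \<phi> \<gamma> \<mu>'"
begin

lemma mlv_step_monic: "monic \<phi>"
  and mlv_step_degree_pos: "0 < degree \<phi>"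
proof -
  have "monic \<phi> \<and> 0 < degree \<phi>"
  proof (cases k)
    case Ordinary
    then have "\<phi> \<in> KP \<mu>"
      using step by simp
    then show ?thesis
      using KP_monic KP_degree_pos[OF \<mu>] by blast
  next
    case (Limit I \<rho>)
    then have "val_family v I \<rho>" "\<phi> \<in> KP_inf I \<rho>"
      using step by (simp_all add: essential_continuous_family_def)
    then show ?thesis
      using KP_inf_monic KP_inf_degree_pos by blast
  qed
  then show "monic \<phi>" "0 < degree \<phi>"
    by blast+
qed

text \<open>A common interface to the two kinds of step. The witness \<open>\<rho>\<close> is
  \<open>\<mu>\<close> itself in an ordinary step and a sufficiently late member of the family in a
  limit step.\<close>

lemma
  shows mlv_step_val_minimal: "val_minimal \<mu>' \<phi>"
    and mlv_step_self: "\<mu>' \<phi> = \<gamma>"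
    and mlv_step_val_prime: "val_prime \<mu>' \<phi>"
    and mlv_step_le: "\<mu> f \<le> \<mu>' f"
    and mlv_step_witness: "degree a < degree \<phi> \<Longrightarrow> degree b < degree \<phi> \<Longrightarrow> degree c < degree \<phi> \<Longrightarrow>
      \<exists>\<rho>. is_valuation \<rho> \<and> \<rho> a = \<mu>' a \<and> \<rho> b = \<mu>' b \<and> \<rho> c = \<mu>' c \<and> \<rho> \<phi> < \<mu>' \<phi>"
proof -
  have "val_minimal \<mu>' \<phi> \<and> \<mu>' \<phi> = \<gamma> \<and> val_prime \<mu>' \<phi> \<and> \<mu> f \<le> \<mu>' f \<and>
    (degree a < degree \<phi> \<longrightarrow> degree b < degree \<phi> \<longrightarrow> degree c < degree \<phi> \<longrightarrow>
      (\<exists>\<rho>. is_valuation \<rho> \<and> \<rho> a = \<mu>' a \<and> \<rho> b = \<mu>' b \<and> \<rho> c = \<mu>' c \<and> \<rho> \<phi> < \<mu>' \<phi>))"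
  proof (cases k)
    case Ordinary
    then have KP: "\<phi> \<in> KP \<mu>" and lt: "\<mu> \<phi> < \<gamma>" and aug: "\<mu>' = augmentation \<mu> \<phi> \<gamma>"
      using step by auto
    note deg = KP_degree_pos[OF \<mu> KP] and \<mu>0 = val_0[OF \<mu>] and \<mu>1 = val_1[OF \<mu>]
    have low: "\<mu>' f = \<mu> f" if "degree f < degree \<phi>" for f
      unfolding aug using augmentation_low[of \<mu>, OF \<mu>0 deg that] .
    have self: "\<mu>' \<phi> = \<gamma>"
      unfolding aug by (rule augmentation_self[of \<mu>, OF \<mu>0 deg \<mu>1])
    have "val_minimal \<mu>' \<phi>"
      using augmentation_val_minimal[of \<mu>, OF \<mu>0 deg \<mu>1] \<mu>' by (simp add: aug)
    moreover have "val_prime \<mu>' \<phi>"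
      by (rule val_prime_cong[OF KP_val_prime[OF \<mu> KP] deg low])
    moreover have "\<mu> f \<le> \<mu>' f"
      unfolding aug using lt by (intro le_augmentation[OF \<mu> KP_val_minimal[OF \<mu> KP] deg]) simp
    ultimately show ?thesis
      using low self lt \<mu> by (auto intro!: exI[of _ \<mu>])
  next
    case (Limit I \<rho>)
    then have fam: "val_family v I \<rho>" and phi: "\<phi> \<in> KP_inf I \<rho>" and \<gamma>: "\<And>i. i \<in> I \<Longrightarrow> \<rho> i \<phi> < \<gamma>"
      and aug: "\<mu>' = augmentation (limit_val I \<rho>) \<phi> \<gamma>" and first: "\<exists>i\<in>I. \<rho> i = \<mu>"
      using step by (auto simp: essential_continuous_family_def)
    note val = \<mu>'[unfolded aug]
    show ?thesis
      unfolding aug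
      using limit_augmentation_val_minimal[OF fam phi \<gamma> val] limit_augmentation_self[OF fam phi \<gamma> val]
        limit_augmentation_val_prime[OF fam phi \<gamma> val]
        family_le_limit_augmentation[OF fam phi \<gamma> val, of _ f]
        limit_augmentation_witness[OF fam phi \<gamma> val, of a b c] first
      by blast
  qed
  then show "val_minimal \<mu>' \<phi>" "\<mu>' \<phi> = \<gamma>" "val_prime \<mu>' \<phi>" "\<mu> f \<le> \<mu>' f"
    "degree a < degree \<phi> \<Longrightarrow> degree b < degree \<phi> \<Longrightarrow> degree c < degree \<phi> \<Longrightarrow>
      \<exists>\<rho>. is_valuation \<rho> \<and> \<rho> a = \<mu>' a \<and> \<rho> b = \<mu>' b \<and> \<rho> c = \<mu>' c \<and> \<rho> \<phi> < \<mu>' \<phi>"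
    by blast+
qed

text \<open>The hypothesis stands for zero support, via \<open>KP_trivial_support\<close>. In a
  chain it is supplied by the step that leaves \<open>\<mu>'\<close>, and it fails for the final
  valuation.\<close>

lemma mlv_step_KP:
  assumes "KP \<mu>' \<noteq> {}"
  shows "\<phi> \<in> KP \<mu>'" and "val_deg \<mu>' = degree \<phi>"
proof -
  obtain \<psi> where "\<psi> \<in> KP \<mu>'"
    using assms by blast
  then show KP: "\<phi> \<in> KP \<mu>'"
    using mlv_step_monic mlv_step_degree_pos mlv_step_val_minimal mlv_step_val_prime
      KP_trivial_support[OF \<mu>']
    by (intro KP_I[OF \<mu>']) blast+
  show "val_deg \<mu>' = degree \<phi>"
  proof (rule val_deg_eq[OF KP])
    fix \<psi> assume "\<psi> \<in> KP \<mu>'"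
    then show "degree \<phi> \<le> degree \<psi>"
      using mlv_step_witness
      by (intro degree_le_of_val_minimal[OF \<mu>' mlv_step_monic] KP_monic
          KP_degree_pos[OF \<mu>'] KP_val_minimal[OF \<mu>'])
  qed
qed

end

section \<open>Weights\<close>

lemma wt_eq:
  fixes v :: "'a::field \<Rightarrow> 'g::linordered_ab_group_add with_top"
  assumes "is_divisible_hull (value_group v)" and "0 < degree f"
  shows "nsmul (degree f) (wt v F f) = root_val v F f"
  unfolding wt_def
proof (rule theI')
  have ex: "\<exists>q. nsmul (degree f) q = root_val v F f"
  proof (cases "root_val v F f")
    case (Fin x)
    obtain y where "nsmul (degree f) y = x"
      using assms unfolding is_divisible_hull_def by blast
    then show ?thesis
      using Fin by (intro exI[of _ "Fin y"]) (simp add: nsmul_Fin)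
  next
    case Infty
    then show ?thesis
      using assms(2) by (intro exI[of _ Infty]) (simp add: nsmul_Infty)
  qed
  have "x = y" if "nsmul (degree f) x = nsmul (degree f) y" for x y :: "'g with_top"
    using that assms(2) nsmul_le_cancel[of "degree f" x y] nsmul_le_cancel[of "degree f" y x] by auto
  with ex show "\<exists>!q. nsmul (degree f) q = root_val v F f"
    by metis
qed

text \<open>The valuation estimates are stated with \<open>nsmul\<close>, without division;
  cross-multiplication turns them into statements about weights.\<close>

lemma wt_le_iff:
  fixes v :: "'a::field \<Rightarrow> 'g::linordered_ab_group_add with_top"
  assumes "is_divisible_hull (value_group v)" and "0 < degree f" and "0 < degree g"
  shows "wt v F f \<le> wt v F g \<longleftrightarrow>
    nsmul (degree g) (root_val v F f) \<le> nsmul (degree f) (root_val v F g)"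
proof -
  have "nsmul (degree g) (root_val v F f) = nsmul (degree f * degree g) (wt v F f)"
    using wt_eq[OF assms(1,2), of F, symmetric] by (simp add: nsmul_mult[symmetric] mult.commute)
  moreover have "nsmul (degree f) (root_val v F g) = nsmul (degree f * degree g) (wt v F g)"
    using wt_eq[OF assms(1,3), of F, symmetric] by (simp add: nsmul_mult[symmetric])
  ultimately show ?thesis
    using nsmul_le_cancel nsmul_mono assms(2,3) by (metis nat_0_less_mult_iff)
qed

lemma wt_less_iff:
  fixes v :: "'a::field \<Rightarrow> 'g::linordered_ab_group_add with_top"
  assumes "is_divisible_hull (value_group v)" and "0 < degree f" and "0 < degree g"
  shows "wt v F f < wt v F g \<longleftrightarrow>
    nsmul (degree g) (root_val v F f) < nsmul (degree f) (root_val v F g)"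
  using wt_le_iff[OF assms(1,3,2)] by (simp add: not_le[symmetric])

section \<open>The frame of an MLV chain\<close>

locale mlv_okutsu =
  fixes v :: "'a::field \<Rightarrow> 'g::linordered_ab_group_add with_top"
    and F :: "'a poly"
    and r :: nat
    and \<mu> :: "nat \<Rightarrow> 'a poly \<Rightarrow> 'g with_top"
    and \<phi> :: "nat \<Rightarrow> 'a poly"
    and \<gamma> :: "nat \<Rightarrow> 'g with_top"
    and k :: "nat \<Rightarrow> ('i::linorder, 'a poly \<Rightarrow> 'g with_top) step_kind"
    and \<chi> :: "nat \<Rightarrow> 'i \<Rightarrow> 'a poly"
  assumes div: "is_divisible_hull (value_group v)"
    and F_monic: "monic F" and F_irreducible: "irreducible F"
    and chain: "mlv_chain v (root_val v F) (Suc r) \<mu> \<phi> \<gamma> k"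
    and last: "\<phi> (Suc r) = F" "\<gamma> (Suc r) = Infty"
    and chi: "\<And>l I \<rho> i. l \<le> r \<Longrightarrow> k l = Limit I \<rho> \<Longrightarrow> i \<in> I \<Longrightarrow>
           \<chi> l i \<in> KP (\<mu> l) \<and> degree (\<chi> l i) = val_deg (\<mu> l) \<and>
           \<rho> i = augmentation (\<mu> l) (\<chi> l i) (root_val v F (\<chi> l i))"
begin

section \<open>Key polynomials, support and degrees along the chain\<close>

abbreviation "\<nu> \<equiv> root_val v F"

lemma valuation: "n \<le> Suc r \<Longrightarrow> is_valuation (\<mu> n)"
  using chain by (auto simp: mlv_chain_def poly_valuation_def)

lemma last_eq: "\<mu> (Suc r) = \<nu>"
  using chain by (simp add: mlv_chain_def)

lemma \<nu>_valuation: "is_valuation \<nu>"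
  using valuation[of "Suc r"] last_eq by simp

lemma step: "n \<le> r \<Longrightarrow> mlv_step v (\<mu> n) (\<phi> n) (k n) (\<phi> (Suc n)) (\<gamma> (Suc n)) (\<mu> (Suc n))"
  using chain by (simp add: mlv_chain_def)

lemma step_valuations:
  assumes "n \<le> r"
  shows "is_valuation (\<mu> n)" and "is_valuation (\<mu> (Suc n))"
  using assms by (auto intro: valuation)

lemmas step_facts = step_valuations step

text \<open>A step leaves \<open>\<mu> n\<close>, and it brings a key polynomial along:
  \<open>\<phi> (Suc n)\<close> if it is ordinary, any \<open>\<chi> n i\<close> if it is a limit
  step.\<close>

lemma KP_nonempty:
  assumes "n \<le> r"
  shows "KP (\<mu> n) \<noteq> {}"
proof (cases "k n")
  case Ordinary
  then show ?thesis
    using step[OF assms] by auto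
next
  case (Limit I \<rho>)
  then obtain i where "i \<in> I"
    using step[OF assms] by auto
  then show ?thesis
    using chi[OF assms Limit] by blast
qed

lemma key_polynomial:
  assumes "n \<le> r"
  shows "\<phi> n \<in> KP (\<mu> n)" and "val_deg (\<mu> n) = degree (\<phi> n)"
proof -
  have "\<phi> n \<in> KP (\<mu> n) \<and> val_deg (\<mu> n) = degree (\<phi> n)"
  proof (cases n)
    case 0
    then show ?thesis
      using chain by (simp add: mlv_chain_def)
  next
    case (Suc m)
    then have "m \<le> r"
      using assms by simp
    from mlv_step_KP[OF step_facts[OF this]] show ?thesis
      using KP_nonempty[OF assms] Suc by simp
  qed
  then show "\<phi> n \<in> KP (\<mu> n)" and "val_deg (\<mu> n) = degree (\<phi> n)"
    by blast+
qed

lemma le_\<nu>: "n \<le> Suc r \<Longrightarrow> \<mu> n f \<le> \<nu> f"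
proof (induction n rule: inc_induct)
  case base
  show ?case by (simp add: last_eq)
next
  case (step n)
  then show ?case
    using mlv_step_le[OF step_facts[of n], of f] by simp
qed

text \<open>Read off from the label \<open>Infty\<close> of the last step rather than from the root
  chosen in \<open>root_val\<close>.\<close>

lemma \<nu>_F: "\<nu> F = Infty"
  using mlv_step_self[OF step_facts[of r]] by (simp add: last last_eq)

text \<open>The support is a proper ideal of a principal ideal domain. A member of least degree
  generates it and is a nonunit divisor of the irreducible \<open>F\<close>, hence associated to
  \<open>F\<close>.\<close>

lemma \<nu>_support: "\<nu> f = Infty \<longleftrightarrow> F dvd f"
proof
  assume "F dvd f"
  then show "\<nu> f = Infty"
    using \<nu>_F by (auto simp: val_mult[OF \<nu>_valuation] elim!: dvdE)
next
  assume f: "\<nu> f = Infty"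
  have "\<exists>G. (G \<noteq> 0 \<and> \<nu> G = Infty) \<and> (\<forall>h. h \<noteq> 0 \<and> \<nu> h = Infty \<longrightarrow> degree G \<le> degree h)"
    by (rule ex_has_least_nat[of _ F]) (use \<nu>_F monic_nonzero[OF F_monic] in simp)
  then obtain G where G: "G \<noteq> 0" "\<nu> G = Infty"
    and least: "\<And>h. h \<noteq> 0 \<Longrightarrow> \<nu> h = Infty \<Longrightarrow> degree G \<le> degree h"
    by blast
  have G_dvd: "G dvd h" if "\<nu> h = Infty" for h
  proof -
    have "Infty \<le> \<nu> (h - h div G * G)"
      using that G(2) by (intro val_diff_le[OF \<nu>_valuation]) (simp_all add: val_mult[OF \<nu>_valuation])
    then have "\<nu> (h mod G) = Infty"
      by (simp add: minus_div_mult_eq_mod)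
    then have "h mod G = 0"
      using least[of "h mod G"] degree_mod_less[OF G(1), of h] by fastforce
    then show ?thesis
      by (simp add: dvd_eq_mod_eq_0)
  qed
  have "\<not> is_unit G"
  proof
    assume "is_unit G"
    then obtain c where c: "1 = G * c"
      by (rule dvdE)
    then show False
      using G(2) val_1[OF \<nu>_valuation] val_mult[OF \<nu>_valuation, of G c]
      by (simp add: zero_with_top_def flip: c)
  qed
  have "F dvd G"
  proof -
    obtain c where c: "F = G * c"
      using G_dvd[OF \<nu>_F] by (rule dvdE)
    then have "is_unit c"
      using irreducibleD[OF F_irreducible c] \<open>\<not> is_unit G\<close> by blast
    then show ?thesis
      unfolding c by (simp add: mult_unit_dvd_iff)
  qed
  then show "F dvd f"
    using G_dvd[OF f] by (rule dvd_trans)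
qed

text \<open>The infinite value at \<open>F\<close> excludes key polynomials, so
  \<open>val_deg\<close> takes its second branch. This brings the last step under the same degree
  formula as the others.\<close>

lemma val_deg_\<nu>: "val_deg \<nu> = degree F"
proof -
  have "KP \<nu> = {}"
    using KP_trivial_support[OF \<nu>_valuation] \<nu>_F monic_nonzero[OF F_monic] by blast
  moreover have "(THE G. monic G \<and> irreducible G \<and> {f. \<nu> f = Infty} = {f. G dvd f}) = F"
  proof (rule the_equality)
    show "monic F \<and> irreducible F \<and> {f. \<nu> f = Infty} = {f. F dvd f}"
      using F_monic F_irreducible \<nu>_support by simp
    fix G assume G: "monic G \<and> irreducible G \<and> {f. \<nu> f = Infty} = {f. G dvd f}"
    then have "F dvd f \<longleftrightarrow> G dvd f" for f
      using \<nu>_support by blast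
    from this[of F] this[of G] have "F dvd G" "G dvd F"
      by simp_all
    then show "G = F"
      using G F_monic by (intro monic_dvd_antisym) auto
  qed
  ultimately show ?thesis
    by (simp add: val_deg_def)
qed

lemma val_deg_Suc: "n \<le> r \<Longrightarrow> val_deg (\<mu> (Suc n)) = degree (\<phi> (Suc n))"
  using key_polynomial(2)[of "Suc n"] val_deg_\<nu> last(1) last_eq by (cases "n = r") auto

lemma degree_less:
  assumes "n \<le> r"
  shows "degree (\<phi> n) < degree (\<phi> (Suc n))"
proof (cases "k n")
  case Ordinary
  then show ?thesis
    using step[OF assms] key_polynomial(2)[OF assms] val_deg_Suc[OF assms] by simp
next
  case (Limit I \<rho>)
  then have fam: "val_family v I \<rho>" and phi: "\<phi> (Suc n) \<in> KP_inf I \<rho>"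
    and "enat (val_deg (\<mu> n)) < deg_inf I \<rho>"
    using step[OF assms] by (auto simp: essential_continuous_family_def)
  then show ?thesis
    using deg_inf_eq[OF fam phi] key_polynomial(2)[OF assms] by simp
qed

lemma degree_mono: "m \<le> n \<Longrightarrow> n \<le> Suc r \<Longrightarrow> degree (\<phi> m) \<le> degree (\<phi> n)"
proof (induction n rule: dec_induct)
  case (step n)
  then show ?case
    using degree_less[of n] by simp
qed simp

lemma degree_pos: "n \<le> Suc r \<Longrightarrow> 0 < degree (\<phi> n)"
  using degree_mono[of 0 n] chain by (simp add: mlv_chain_def)

section \<open>Limit steps and agreement of the valuations in low degrees\<close>

lemma limit_step:
  assumes "n \<le> r" and "k n = Limit I \<rho>"
  shows "val_family v I \<rho>" and "\<phi> (Suc n) \<in> KP_inf I \<rho>"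
    and "\<And>i. i \<in> I \<Longrightarrow> \<rho> i (\<phi> (Suc n)) < \<gamma> (Suc n)"
    and "\<mu> (Suc n) = augmentation (limit_val I \<rho>) (\<phi> (Suc n)) (\<gamma> (Suc n))"
  using step[OF assms(1)] assms(2) by (auto simp: essential_continuous_family_def)

lemma limit_chi:
  assumes "n \<le> r" and "k n = Limit I \<rho>" and "i \<in> I"
  shows "\<chi> n i \<in> KP (\<mu> n)" and "degree (\<chi> n i) = degree (\<phi> n)"
    and "\<rho> i = augmentation (\<mu> n) (\<chi> n i) (\<nu> (\<chi> n i))"
  using chi[OF assms] key_polynomial(2)[OF assms(1)] by auto

lemma limit_family_low:
  assumes "n \<le> r" and "k n = Limit I \<rho>" and "i \<in> I" and "degree g < degree (\<phi> n)"
  shows "\<rho> i g = \<mu> n g"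
  unfolding limit_chi(3)[OF assms(1-3)]
  using limit_chi(2)[OF assms(1-3)] assms(4)
  by (intro augmentation_low[of "\<mu> n"] val_0[OF step_valuations(1)[OF assms(1)]]) auto

lemma limit_Suc_low:
  assumes "n \<le> r" and "k n = Limit I \<rho>" and "degree g < degree (\<phi> (Suc n))"
  shows "\<mu> (Suc n) g = limit_val I \<rho> g"
  unfolding limit_step(4)[OF assms(1,2)]
  by (rule limit_augmentation_low[OF limit_step(1,2,3)[OF assms(1,2)]])
    (use assms step_valuations(2)[OF assms(1)] limit_step(4)[OF assms(1,2)] in auto)

lemma Suc_low:
  assumes "n \<le> r" and "degree g < degree (\<phi> n)"
  shows "\<mu> (Suc n) g = \<mu> n g"
proof (cases "k n")
  case Ordinary
  then have "\<mu> (Suc n) = augmentation (\<mu> n) (\<phi> (Suc n)) (\<gamma> (Suc n))"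
    using step[OF assms(1)] by simp
  then show ?thesis
    using assms degree_less[OF assms(1)] degree_pos[of "Suc n"]
    by (simp add: augmentation_low[of "\<mu> n"] val_0[OF step_valuations(1)])
next
  case (Limit I \<rho>)
  note fam = limit_step(1)[OF assms(1) Limit]
  have "stable_value I \<rho> g (\<mu> n g)"
    using family_nonempty[OF fam] limit_family_low[OF assms(1) Limit _ assms(2)]
    unfolding stable_value_def by blast
  then show ?thesis
    using limit_Suc_low[OF assms(1) Limit, of g] limit_val_eq[OF fam] assms degree_less[OF assms(1)]
    by simp
qed

lemma \<nu>_low:
  assumes "n \<le> Suc r" and "degree g < degree (\<phi> n)"
  shows "\<nu> g = \<mu> n g"
proof -
  have "n \<le> m \<Longrightarrow> m \<le> Suc r \<Longrightarrow> \<mu> m g = \<mu> n g" for m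
  proof (induction m rule: dec_induct)
    case (step m)
    then show ?case
      using Suc_low[of m g] degree_mono[of n m] assms(2) by simp
  qed simp
  from this[of "Suc r"] show ?thesis
    using assms(1) by (simp add: last_eq)
qed

text \<open>If the values did not increase, then \<open>\<nu> (\<chi> n j) \<le> \<rho> i (\<chi> n j)\<close>, and the \<open>\<chi> n j\<close>-expansion of
  \<open>f\<close> would give \<open>\<rho> j f \<le> \<rho> i f\<close> for every \<open>f\<close>.\<close>

lemma chi_strict_mono:
  assumes n: "n \<le> r" and lim: "k n = Limit I \<rho>" and ij: "i \<in> I" "j \<in> I" "i < j"
  shows "\<nu> (\<chi> n i) < \<nu> (\<chi> n j)"
proof (rule ccontr)
  let ?a = "\<chi> n j - \<chi> n i"
  note ci = limit_chi[OF n lim ij(1)] and cj = limit_chi[OF n lim ij(2)]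
  note w = family_valuation[OF limit_step(1)[OF n lim] ij(1)]
  assume "\<not> ?thesis"
  then have le: "\<nu> (\<chi> n j) \<le> \<nu> (\<chi> n i)"
    by simp
  \<comment> \<open>The leading terms cancel, and in this range \<open>\<nu>\<close> and
    \<open>\<rho> i\<close> agree, which carries a lower bound for \<open>\<nu> ?a\<close> over to
    \<open>\<rho> i\<close>.\<close>
  have dega: "degree ?a < degree (\<phi> n)"
  proof (cases "?a = 0")
    case True
    then show ?thesis
      using degree_pos n by simp
  next
    case False
    have "coeff ?a (degree (\<phi> n)) = 0"
      using KP_monic[OF ci(1)] KP_monic[OF cj(1)] ci(2) cj(2) by (simp add: monic_def)
    moreover have "degree ?a \<le> degree (\<phi> n)"
      using ci(2) cj(2) by (metis degree_diff_le order_refl)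
    ultimately show ?thesis
      using False by (metis leading_coeff_0_iff order_le_less)
  qed
  have "\<nu> (\<chi> n j) \<le> \<nu> ?a"
    using le by (intro val_diff_le[OF \<nu>_valuation]) auto
  also have "\<nu> ?a = \<rho> i ?a"
    using \<nu>_low[of n, OF _ dega] limit_family_low[OF n lim ij(1) dega] n by simp
  finally have "\<nu> (\<chi> n j) \<le> \<rho> i ?a" .
  moreover have "\<rho> i (\<chi> n i) = \<nu> (\<chi> n i)"
    unfolding ci(3) using valuation[of n] n ci(2) degree_pos[of n]
    by (intro augmentation_self[of "\<mu> n"] val_0 val_1) auto
  ultimately have "\<nu> (\<chi> n j) \<le> \<rho> i (\<chi> n j)"
    using le val_add_le[OF w, of "\<nu> (\<chi> n j)" ?a "\<chi> n i"] by simp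
  then have "\<rho> j f \<le> \<rho> i f" for f
    unfolding cj(3)
    using cj(2) degree_pos[of n] n limit_family_low[OF n lim ij(1)]
      valuation[of n]
    by (intro augmentation_le[of "\<mu> n", OF _ _ w] val_0) auto
  then have "\<rho> j \<le> \<rho> i"
    by (simp add: le_fun_def)
  then show False
    using family_less[OF limit_step(1)[OF n lim] ij] by simp
qed

section \<open>Weights of the frame sets\<close>

abbreviation "\<Phi> n \<equiv> frame_set (\<phi> n) (k n) (\<chi> n)"

lemma frame_KP:
  assumes "n \<le> r" and "\<psi> \<in> \<Phi> n"
  shows "\<psi> \<in> KP (\<mu> n)" and "degree \<psi> = degree (\<phi> n)"
  using assms key_polynomial[OF assms(1)] limit_chi[OF assms(1)] by (cases "k n"; auto)+

lemma frame_bound: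
  assumes n: "n \<le> r" and g: "monic g" "degree g < degree (\<phi> (Suc n))"
  shows "\<exists>\<psi>\<in>\<Phi> n. nsmul (degree \<psi>) (\<nu> g) \<le> nsmul (degree g) (\<nu> \<psi>)"
proof (cases "k n")
  case Ordinary
  \<comment> \<open>An ordinary step leaves \<open>\<mu> n\<close> unchanged up to
    \<open>degree (\<phi> (Suc n))\<close>, further than \<open>\<nu>_low\<close> at
    \<open>n\<close> reaches; the range now includes \<open>\<phi> n\<close> itself.\<close>
  have low: "\<nu> h = \<mu> n h" if "degree h < degree (\<phi> (Suc n))" for h
  proof -
    have "\<mu> (Suc n) = augmentation (\<mu> n) (\<phi> (Suc n)) (\<gamma> (Suc n))"
      using step[OF n] Ordinary by simp
    then have "\<mu> (Suc n) h = \<mu> n h"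
      using that degree_pos[of "Suc n"] n
      by (simp add: augmentation_low[of "\<mu> n"] val_0[OF step_valuations(1)])
    then show ?thesis
      using \<nu>_low[of "Suc n" h] that n by simp
  qed
  note val = step_valuations(1)[OF n] and KP = key_polynomial(1)[OF n]
  have "nsmul (degree (\<phi> n)) (\<mu> n g) \<le> nsmul (degree g) (\<mu> n (\<phi> n))"
    by (rule val_minimal_weight[OF val KP_val_minimal[OF val KP] KP_monic[OF KP]
          KP_degree_pos[OF val KP] g(1)])
  then show ?thesis
    using low[OF g(2)] low[OF degree_less[OF n]] Ordinary by simp
next
  case (Limit I \<rho>)
  note fam = limit_step(1)[OF n Limit]
  have "stable I \<rho> g"
    by (rule KP_inf_stable[OF fam limit_step(2)[OF n Limit] g(2)])
  \<comment> \<open>The index depends on \<open>g\<close>, which is why a limit step contributes a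
    whole family to the frame. The bound is then applied to \<open>\<rho> i\<close>, for which
    \<open>\<chi> n i\<close> is minimal.\<close>
  then obtain i where i: "i \<in> I" "\<rho> i g = limit_val I \<rho> g"
    using stableD[OF fam] by blast
  then have \<nu>g: "\<nu> g = \<rho> i g"
    using limit_Suc_low[OF n Limit g(2)] \<nu>_low[of "Suc n" g] n g(2) by simp
  note c = limit_chi[OF n Limit i(1)] and w = family_valuation[OF fam i(1)]
  have deg: "0 < degree (\<chi> n i)"
    using c(2) degree_pos[of n] n by simp
  have "val_minimal (\<rho> i) (\<chi> n i)" "\<rho> i (\<chi> n i) = \<nu> (\<chi> n i)"
    using w deg valuation[of n] n unfolding c(3)
    by (auto intro!: augmentation_val_minimal[of "\<mu> n"] augmentation_self[of "\<mu> n"] val_0 val_1)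
  then have "nsmul (degree (\<chi> n i)) (\<nu> g) \<le> nsmul (degree g) (\<nu> (\<chi> n i))"
    using val_minimal_weight[OF w _ KP_monic[OF c(1)] deg g(1)] \<nu>g by simp
  then show ?thesis
    using Limit i by auto
qed

text \<open>In an ordinary step \<open>\<phi> n\<close> and \<open>\<phi> (Suc n)\<close> have the
  same weight under \<open>\<mu> n\<close>, and the augmentation raises only the latter. In a limit
  step the weight bound for \<open>\<mu> (Suc n)\<close> is not strict; passing from
  \<open>\<chi> n i\<close> to a later \<open>\<chi> n j\<close> makes it so.\<close>

lemma frame_less:
  assumes n: "n \<le> r" and \<psi>: "\<psi> \<in> \<Phi> n"
  shows "nsmul (degree (\<phi> (Suc n))) (\<nu> \<psi>) < nsmul (degree (\<phi> n)) (\<gamma> (Suc n))"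
proof -
  note val = step_valuations[OF n] and pos = degree_pos[of n] degree_pos[of "Suc n"]
  show ?thesis
  proof (cases "k n")
    case Ordinary
    then have psi: "\<psi> = \<phi> n" and KP: "\<phi> (Suc n) \<in> KP (\<mu> n)" and lt: "\<mu> n (\<phi> (Suc n)) < \<gamma> (Suc n)"
      and aug: "\<mu> (Suc n) = augmentation (\<mu> n) (\<phi> (Suc n)) (\<gamma> (Suc n))"
      using \<psi> step[OF n] by auto
    have "\<nu> (\<phi> n) = \<mu> n (\<phi> n)"
      using \<nu>_low[of "Suc n" "\<phi> n"] degree_less[OF n] n pos
      by (simp add: aug augmentation_low[of "\<mu> n"] val_0[OF val(1)])
    then have "nsmul (degree (\<phi> (Suc n))) (\<nu> \<psi>) = nsmul (degree (\<phi> n)) (\<mu> n (\<phi> (Suc n)))"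
      using val_minimal_weight_eq[OF val(1), of "\<phi> (Suc n)" "\<phi> n"] KP_val_minimal[OF val(1)]
        KP_monic KP key_polynomial(1)[OF n] pos n
      unfolding psi by auto
    also have "\<dots> < nsmul (degree (\<phi> n)) (\<gamma> (Suc n))"
      using lt pos n by (intro nsmul_strict_mono) auto
    finally show ?thesis .
  next
    case (Limit I \<rho>)
    then obtain i where i: "i \<in> I" "\<psi> = \<chi> n i"
      using \<psi> by auto
    obtain j where j: "j \<in> I" "i < j"
      using family_next[OF limit_step(1)[OF n Limit] i(1)] by blast
    note c = limit_chi[OF n Limit j(1)]
    have "nsmul (degree (\<phi> (Suc n))) (\<nu> \<psi>) < nsmul (degree (\<phi> (Suc n))) (\<nu> (\<chi> n j))"
      using chi_strict_mono[OF n Limit i(1) j] pos n i(2) by (intro nsmul_strict_mono) auto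
    also have "\<nu> (\<chi> n j) = \<mu> (Suc n) (\<chi> n j)"
      using \<nu>_low[of "Suc n"] c(2) degree_less[OF n] n by simp
    also have "nsmul (degree (\<phi> (Suc n))) (\<mu> (Suc n) (\<chi> n j))
        \<le> nsmul (degree (\<chi> n j)) (\<mu> (Suc n) (\<phi> (Suc n)))"
      using pos n
      by (intro val_minimal_weight[OF val(2)] mlv_step_val_minimal[OF step_facts[OF n]]
          mlv_step_monic[OF step_facts[OF n]] KP_monic[OF c(1)]) auto
    also have "\<dots> = nsmul (degree (\<phi> n)) (\<gamma> (Suc n))"
      using c(2) mlv_step_self[OF step_facts[OF n]] by simp
    finally show ?thesis .
  qed
qed

text \<open>Key polynomials of \<open>\<mu> (Suc n)\<close> of equal degree have equal value under
  it, here \<open>\<gamma> (Suc n)\<close>, and \<open>\<nu>\<close> dominates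
  \<open>\<mu> (Suc n)\<close>.\<close>

lemma frame_ge:
  assumes n: "n < r" and \<psi>: "\<psi> \<in> \<Phi> (Suc n)"
  shows "\<gamma> (Suc n) \<le> \<nu> \<psi>"
proof -
  have n': "n \<le> r" "Suc n \<le> r"
    using n by auto
  note val = step_valuations(2)[OF n'(1)] and \<psi>' = frame_KP[OF n'(2) \<psi>]
    and KP = key_polynomial(1)[OF n'(2)]
  have eq: "nsmul (degree \<psi>) (\<mu> (Suc n) (\<phi> (Suc n))) = nsmul (degree \<psi>) (\<mu> (Suc n) \<psi>)"
    using val_minimal_weight_eq[OF val KP_val_minimal[OF val \<psi>'(1)] KP_monic[OF \<psi>'(1)]
        KP_degree_pos[OF val \<psi>'(1)] KP_val_minimal[OF val KP] KP_monic[OF KP] KP_degree_pos[OF val KP]]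
    by (simp only: \<psi>'(2))
  have "\<mu> (Suc n) (\<phi> (Suc n)) \<le> \<mu> (Suc n) \<psi>"
    by (rule nsmul_le_cancel[OF eq_refl[OF eq] KP_degree_pos[OF val \<psi>'(1)]])
  then show ?thesis
    using mlv_step_self[OF step_facts[OF n'(1)]] le_\<nu>[of "Suc n" \<psi>] n by simp
qed

lemma frame_step_less:
  assumes n: "n \<le> r" and \<psi>: "\<psi> \<in> \<Phi> n" and \<psi>': "\<psi>' \<in> (if n = r then {F} else \<Phi> (Suc n))"
  shows "wt v F \<psi> < wt v F \<psi>'"
proof -
  have "\<gamma> (Suc n) \<le> \<nu> \<psi>'" "degree \<psi>' = degree (\<phi> (Suc n))"
    using \<psi>' frame_ge[of n \<psi>'] frame_KP(2)[of "Suc n" \<psi>'] n \<nu>_F last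
    by (auto split: if_splits)
  moreover have "degree \<psi> = degree (\<phi> n)"
    by (rule frame_KP(2)[OF n \<psi>])
  ultimately show ?thesis
    using frame_less[OF n \<psi>] degree_pos[of n] degree_pos[of "Suc n"] n
      nsmul_mono[of "\<gamma> (Suc n)" "\<nu> \<psi>'" "degree (\<phi> n)"]
    by (auto simp: wt_less_iff[OF div] intro: less_le_trans)
qed

text \<open>Leaves the cardinality condition (OF1) to the ordinary steps, whose frame sets are
  singletons.\<close>

lemma limit_no_max:
  assumes n: "n \<le> r" and lim: "k n = Limit I \<rho>"
  shows "\<not> has_max (weight_set v F (degree (\<phi> (Suc n))))"
proof
  assume "has_max (weight_set v F (degree (\<phi> (Suc n))))"
  then obtain g where g: "monic g" "0 < degree g" "degree g < degree (\<phi> (Suc n))"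
    and max: "\<And>h. monic h \<Longrightarrow> 0 < degree h \<Longrightarrow> degree h < degree (\<phi> (Suc n)) \<Longrightarrow> wt v F h \<le> wt v F g"
    unfolding has_max_def weight_set_def by blast
  obtain i where i: "i \<in> I" "nsmul (degree (\<chi> n i)) (\<nu> g) \<le> nsmul (degree g) (\<nu> (\<chi> n i))"
    using frame_bound[OF n g(1,3)] lim by auto
  obtain j where j: "j \<in> I" "i < j"
    using family_next[OF limit_step(1)[OF n lim] i(1)] by blast
  note ci = limit_chi[OF n lim i(1)] and cj = limit_chi[OF n lim j(1)]
  have pos: "0 < degree (\<phi> n)"
    using degree_pos n by simp
  have "wt v F g \<le> wt v F (\<chi> n i)"
    using i(2) g(2) ci(2) pos by (simp add: wt_le_iff[OF div])
  also have "\<dots> < wt v F (\<chi> n j)"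
    using nsmul_strict_mono[OF chi_strict_mono[OF n lim i(1) j] pos] ci(2) cj(2) pos
    by (simp add: wt_less_iff[OF div])
  also have "\<dots> \<le> wt v F g"
    using cj pos degree_less[OF n] by (intro max KP_monic) auto
  finally show False
    by simp
qed

lemma frame_inj: "n \<le> r \<Longrightarrow> inj_on \<nu> (\<Phi> n)"
proof (cases "k n")
  case (Limit I \<rho>)
  assume n: "n \<le> r"
  have "i = j" if "i \<in> I" "j \<in> I" "\<nu> (\<chi> n i) = \<nu> (\<chi> n j)" for i j
    using chi_strict_mono[OF n Limit that(1,2)] chi_strict_mono[OF n Limit that(2,1)] that(3)
    by (metis less_irrefl linorder_cases)
  then show ?thesis
    using Limit by (auto intro!: inj_onI)
qed simp

lemma okutsu_frame: "okutsu_frame v F (map \<Phi> [0..<Suc r] @ [{F}])"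
proof -
  let ?L = "map \<Phi> [0..<Suc r] @ [{F}]"
  have L: "?L ! n = \<Phi> n" if "n \<le> r" for n
    using that by (simp add: nth_append del: upt_Suc)
  have LF: "?L ! Suc r = {F}"
    by (simp add: nth_append del: upt_Suc)
  have L_Suc: "?L ! Suc n = (if n = r then {F} else \<Phi> (Suc n))" if "n \<le> r" for n
  proof (cases "n = r")
    case True
    then show ?thesis
      by (simp only: LF if_True simp_thms)
  next
    case False
    then show ?thesis
      using that L[of "Suc n"] by (simp only: if_False)
  qed
  have nonempty: "\<Phi> n \<noteq> {}" if "n \<le> r" for n
    using family_nonempty[OF limit_step(1)[OF that]] by (cases "k n") auto
  have elements: "monic \<psi> \<and> irreducible \<psi> \<and> degree \<psi> = degree (\<phi> n)" if "n \<le> r" "\<psi> \<in> \<Phi> n" for n \<psi>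
    using frame_KP[OF that] KP_monic KP_irreducible[OF valuation[of n]] that(1) by auto
  have deg0: "degree (\<phi> 0) = 1"
    using chain by (simp add: mlv_chain_def)
  have bound: "\<exists>\<psi>\<in>\<Phi> n. wt v F g \<le> wt v F \<psi>"
    if n: "n \<le> r" and g: "monic g" "0 < degree g" "degree g < degree (\<phi> (Suc n))" for n g
  proof -
    obtain \<psi> where "\<psi> \<in> \<Phi> n" "nsmul (degree \<psi>) (\<nu> g) \<le> nsmul (degree g) (\<nu> \<psi>)"
      using frame_bound[OF n g(1,3)] by blast
    moreover from this have "0 < degree \<psi>"
      using frame_KP(2)[OF n] degree_pos[of n] n by simp
    ultimately show ?thesis
      using wt_le_iff[OF div g(2)] by blast
  qed
  have single: "card (\<Phi> n) = 1" if "n \<le> r" "has_max (weight_set v F (degree (\<phi> (Suc n))))" for n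
    using limit_no_max[OF that(1)] that(2) by (cases "k n") auto
  show ?thesis
    unfolding okutsu_frame_def
  \<comment> \<open>Since \<open>\<phi> (Suc r) = F\<close>, the same formula for the degrees covers
    the last entry \<open>{F}\<close>.\<close>
  proof (intro exI[of _ r] exI[of _ "\<lambda>n. degree (\<phi> n)"] conjI)
    show "\<forall>l\<le>r + 1. ?L ! l \<noteq> {} \<and> (\<forall>\<psi>\<in>?L ! l. monic \<psi> \<and> irreducible \<psi> \<and> degree \<psi> = degree (\<phi> l))"
    proof (intro allI impI)
      fix l assume "l \<le> r + 1"
      then consider "l \<le> r" | "l = Suc r" by linarith
      then show "?L ! l \<noteq> {} \<and> (\<forall>\<psi>\<in>?L ! l. monic \<psi> \<and> irreducible \<psi> \<and> degree \<psi> = degree (\<phi> l))"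
      proof cases
        case 1
        then show ?thesis
          using nonempty elements by (simp only: L) blast
      next
        case 2
        then show ?thesis
          using F_monic F_irreducible last by (simp only: LF) simp
      qed
    qed
    show "\<forall>l\<le>r. \<forall>\<psi>\<in>?L ! l. \<forall>\<psi>'\<in>?L ! (l + 1). wt v F \<psi> < wt v F \<psi>'"
    proof (intro allI impI ballI)
      fix l \<psi> \<psi>' assume l: "l \<le> r" and "\<psi> \<in> ?L ! l" "\<psi>' \<in> ?L ! (l + 1)"
      then show "wt v F \<psi> < wt v F \<psi>'"
        using frame_step_less[OF l] by (simp only: L[OF l] L_Suc[OF l] Suc_eq_plus1[symmetric])
    qed
    show "\<forall>l\<le>r. \<forall>g. monic g \<and> 0 < degree g \<and> degree g < degree (\<phi> (l + 1)) \<longrightarrow>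
        (\<exists>\<psi>\<in>?L ! l. wt v F g \<le> wt v F \<psi>)"
    proof (intro allI impI)
      fix l and g :: "'a poly"
      assume l: "l \<le> r" and "monic g \<and> 0 < degree g \<and> degree g < degree (\<phi> (l + 1))"
      then show "\<exists>\<psi>\<in>?L ! l. wt v F g \<le> wt v F \<psi>"
        using bound[OF l, of g] unfolding L[OF l] by simp
    qed
    show "\<forall>l\<le>r. has_max (weight_set v F (degree (\<phi> (l + 1)))) \<longrightarrow> card (?L ! l) = 1"
    proof (intro allI impI)
      fix l assume l: "l \<le> r" and "has_max (weight_set v F (degree (\<phi> (l + 1))))"
      then show "card (?L ! l) = 1"
        using single[OF l] unfolding L[OF l] by simp
    qed
    show "\<forall>l\<le>r. \<not> has_max (weight_set v F (degree (\<phi> (l + 1)))) \<longrightarrow> inj_on \<nu> (?L ! l)"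
    proof (intro allI impI)
      fix l assume l: "l \<le> r"
      then show "inj_on \<nu> (?L ! l)"
        using frame_inj[OF l] by (simp only: L[OF l])
    qed
    show "\<forall>l\<le>r. degree (\<phi> l) < degree (\<phi> (l + 1))"
      using degree_less by simp
    show "length ?L = r + 2"
      by simp
    show "?L ! (r + 1) = {F}"
      by (simp only: LF Suc_eq_plus1[symmetric])
    show "degree (\<phi> (r + 1)) = degree F"
      by (simp add: last)
  qed (rule deg0)
qed

end

theorem theorem4p4:
  fixes v :: "'a::field \<Rightarrow> 'g::linordered_ab_group_add with_top"
    and F :: "'a poly"
    and r :: nat
    and \<mu> :: "nat \<Rightarrow> 'a poly \<Rightarrow> 'g with_top"
    and \<phi> :: "nat \<Rightarrow> 'a poly"
    and \<gamma> :: "nat \<Rightarrow> 'g with_top"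
    and k :: "nat \<Rightarrow> ('i::linorder, 'a poly \<Rightarrow> 'g with_top) step_kind"
    and \<chi> :: "nat \<Rightarrow> 'i \<Rightarrow> 'a poly"
  assumes "is_divisible_hull (value_group v)" and "henselian v"
    and "monic F" and "Factorial_Ring.irreducible F" and "Polynomial.degree F > 1"
    and "mlv_chain v (root_val v F) (Suc r) \<mu> \<phi> \<gamma> k"
    and "\<phi> (Suc r) = F" and "\<gamma> (Suc r) = Infty"
    and "\<And>l I \<rho> i. l \<le> r \<Longrightarrow> k l = Limit I \<rho> \<Longrightarrow> i \<in> I \<Longrightarrow>
           \<chi> l i \<in> KP (\<mu> l) \<and> Polynomial.degree (\<chi> l i) = val_deg (\<mu> l) \<and>
           \<rho> i = augmentation (\<mu> l) (\<chi> l i) (root_val v F (\<chi> l i))"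
  shows "okutsu_frame v F (map (\<lambda>l. frame_set (\<phi> l) (k l) (\<chi> l)) [0..<Suc r] @ [{F}])"
proof -
  interpret mlv_okutsu v F r \<mu> \<phi> \<gamma> k \<chi>
    using assms by unfold_locales
  show ?thesis
    by (rule okutsu_frame)
qed

end
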